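(* Let $G$ be a compact, Hausdorff, second countable topological group, and let $m(G)$ be a positive integer such that every non-trivial complex continuous representation of $G$ has dimension at least $m(G)$. Let $f_1,f_2\in L^2(G)$ and suppose that at least one of $f_1,f_2$ has mean zero. Then \[ \|f_1\ast f_2\|_2\le \sqrt{\frac{1}{m(G)}}\,\|f_1\|_2\,\|f_2\|_2. \]
   Context: $\mu$ is the (bi-invariant) Haar measure on $G$ normalized by $\mu(G)=1$, and $L^2(G)=L^2(G,\mu)$ consists of complex-valued functions, with norm $\|\cdot\|_2$. A function $f$ has mean zero if $\int_G f\,d\mu=0$. Convolution is $(f_1\ast f_2)(x)=\int_G f_1(xy^{-1})f_2(y)\,d\mu(y)$. Representations are finite-dimensional; a representation is non-trivial if it is not the constant homomorphism to the identity. *)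

theory Defs
  imports "HOL-Analysis.Analysis" "Jordan_Normal_Form.Matrix"
begin

text \<open>
  A topological group is a type of class \<^class>\<open>topological_group_add\<close>. That class is written
  additively but does not assume commutativity: \<open>x + y\<close>, \<open>0\<close> and \<open>x - y\<close> stand for
  the group product, the identity and \<open>x y\<^sup>-\<^sup>1\<close>.
\<close>

text \<open>
  On a compact second countable Hausdorff group every finite Borel measure is regular, so no
  regularity is required here.
\<close>

definition normalized_haar_measure :: "'a::topological_group_add measure \<Rightarrow> bool" where
  "normalized_haar_measure \<mu> \<longleftrightarrow>
     sets \<mu> = sets borel \<and> emeasure \<mu> UNIV = 1 \<and>
     (\<forall>g. distr \<mu> borel (\<lambda>x. g + x) = \<mu>) \<and>
     (\<forall>g. distr \<mu> borel (\<lambda>x. x + g) = \<mu>)"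

text \<open>Elements of \<open>L\<^sup>2(\<mu>)\<close> are represented by functions, not by almost-everywhere classes.\<close>

definition L2_space :: "'a measure \<Rightarrow> ('a \<Rightarrow> complex) set" where
  "L2_space \<mu> = {f \<in> borel_measurable \<mu>. integrable \<mu> (\<lambda>x. (cmod (f x))\<^sup>2)}"

definition L2_norm :: "'a measure \<Rightarrow> ('a \<Rightarrow> complex) \<Rightarrow> real" where
  "L2_norm \<mu> f = sqrt (\<integral>x. (cmod (f x))\<^sup>2 \<partial>\<mu>)"

text \<open>
  For \<open>f\<^sub>1\<close> and \<open>f\<^sub>2\<close> in \<open>L\<^sup>2\<close> of the Haar measure of a compact group, the integrand below is
  integrable for every \<open>x\<close> by the Cauchy-Schwarz inequality.
\<close>

definition convolution ::
  "'a::group_add measure \<Rightarrow> ('a \<Rightarrow> complex) \<Rightarrow> ('a \<Rightarrow> complex) \<Rightarrow> 'a \<Rightarrow> complex" where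
  "convolution \<mu> f\<^sub>1 f\<^sub>2 = (\<lambda>x. \<integral>y. f\<^sub>1 (x - y) * f\<^sub>2 y \<partial>\<mu>)"

text \<open>
  A representation of dimension \<open>n\<close> is a homomorphism to \<open>GL\<^sub>n(\<complex>)\<close>; invertibility of the
  values follows from the homomorphism laws. Continuity is entrywise.
\<close>

definition continuous_representation ::
  "nat \<Rightarrow> ('a::topological_group_add \<Rightarrow> complex mat) \<Rightarrow> bool" where
  "continuous_representation n \<pi> \<longleftrightarrow>
     (\<forall>x. \<pi> x \<in> carrier_mat n n) \<and>
     \<pi> 0 = 1\<^sub>m n \<and>
     (\<forall>x y. \<pi> (x + y) = \<pi> x * \<pi> y) \<and>
     (\<forall>i<n. \<forall>j<n. continuous_on UNIV (\<lambda>x. \<pi> x $$ (i, j)))"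

definition nontrivial_representation ::
  "nat \<Rightarrow> ('a \<Rightarrow> complex mat) \<Rightarrow> bool" where
  "nontrivial_representation n \<pi> \<longleftrightarrow> (\<exists>x. \<pi> x \<noteq> 1\<^sub>m n)"

end

theory Submission
  imports Defs "HOL-Complex_Analysis.Great_Picard"
begin

text \<open>
  Convolution by a square-integrable \<open>f\<close> is the Hilbert-Schmidt operator \<open>T h = f * h\<close> with
  kernel \<open>f (x - y)\<close>, whose Hilbert-Schmidt norm is \<open>\<parallel>f\<parallel>\<close>. Let \<open>\<Lambda>\<close> be the supremum of
  \<open>\<parallel>T h\<parallel>\<^sup>2\<close> over mean-zero \<open>h\<close> in the unit ball. If it is positive, it is the
  largest eigenvalue of \<open>T\<^sup>* T\<close> on the functions of mean zero.
  The operator \<open>T\<close> commutes with right translations, so the eigenspace \<open>E\<close> of \<open>\<Lambda>\<close> is a representation of the group. It contains no nonzero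
  translation-invariant function, because such a function is constant and \<open>E\<close> consists of
  functions of mean zero; hence \<open>m \<le> dim E\<close>. On the other hand each vector of an orthonormal basis
  of \<open>E\<close> contributes \<open>\<Lambda>\<close> to the squared Hilbert-Schmidt norm, so \<open>dim E \<cdot> \<Lambda> \<le> \<parallel>f\<parallel>\<^sup>2\<close>.
  Together \<open>\<Lambda> \<le> \<parallel>f\<parallel>\<^sup>2 / m\<close>, which is the claim when the second factor has mean zero. When the
  first factor has mean zero it annihilates constants, and the second factor can be replaced by its
  mean-zero part without increasing its norm.

  The spectral theory is done by hand and on functions instead of almost-everywhere classes.
  The analytic input is that translations act continuously on \<open>L\<^sup>2\<close>
  (\<open>L2_continuity\<close>). It makes the functions \<open>T h\<close>, for \<open>h\<close> in the unit
  ball, equicontinuous, so that every sequence of them has an everywhere convergent subsequence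
  (\<open>convolution_compact\<close>); from a maximizing sequence one then obtains an
  eigenvector (\<open>extremal_eigenfunction\<close>). It also makes the matrix coefficients of \<open>E\<close>
  continuous (\<open>translation_matrix_representation\<close>). The bound on the dimension is Bessel's
  inequality applied to every row of the kernel (\<open>Hilbert_Schmidt_bound\<close>), and the two
  estimates of \<open>dim E\<close> are combined in \<open>conv_gain_le\<close>.
\<close>

section \<open>Square-integrable functions\<close>

lemma L2_measurable [measurable_dest]: "f \<in> L2_space M \<Longrightarrow> f \<in> borel_measurable M"
  by (simp add: L2_space_def)

lemma L2_integrable_square: "f \<in> L2_space M \<Longrightarrow> integrable M (\<lambda>x. (cmod (f x))\<^sup>2)"
  by (simp add: L2_space_def)

lemma L2_norm_nonneg [simp]: "0 \<le> L2_norm M f"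
  by (simp add: L2_norm_def)

lemma L2_norm_square: "(L2_norm M f)\<^sup>2 = (\<integral>x. (cmod (f x))\<^sup>2 \<partial>M)"
  by (simp add: L2_norm_def)

lemma L2_space_dominated:
  assumes "g \<in> borel_measurable M" "f \<in> L2_space M" "\<And>x. cmod (g x) \<le> c * cmod (f x)"
  shows "g \<in> L2_space M"
proof -
  note [measurable] = assms(1)
  have "(cmod (g x))\<^sup>2 \<le> c\<^sup>2 * (cmod (f x))\<^sup>2" for x
    using power_mono[OF assms(3), of x 2] by (simp add: power_mult_distrib)
  then have "integrable M (\<lambda>x. (cmod (g x))\<^sup>2)"
    using assms(2)
    by (intro Bochner_Integration.integrable_bound[of M "\<lambda>x. c\<^sup>2 * (cmod (f x))\<^sup>2" "\<lambda>x. (cmod (g x))\<^sup>2"])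
      (auto simp: L2_integrable_square)
  then show ?thesis by (simp add: L2_space_def)
qed

lemma L2_cmult: "f \<in> L2_space M \<Longrightarrow> (\<lambda>x. c * f x) \<in> L2_space M"
  by (rule L2_space_dominated[where c = "cmod c" and f = f]) (auto simp: norm_mult)

lemma L2_cnj: "f \<in> L2_space M \<Longrightarrow> (\<lambda>x. cnj (f x)) \<in> L2_space M"
  by (rule L2_space_dominated[where c = 1 and f = f])
    (auto intro: borel_measurable_continuous_on[of cnj] continuous_intros)

lemma L2_add:
  assumes "f \<in> L2_space M" "g \<in> L2_space M"
  shows "(\<lambda>x. f x + g x) \<in> L2_space M"
proof -
  have [measurable]: "f \<in> borel_measurable M" "g \<in> borel_measurable M"
    using assms by (auto dest: L2_measurable)
  have "(cmod (f x + g x))\<^sup>2 \<le> 2 * (cmod (f x))\<^sup>2 + 2 * (cmod (g x))\<^sup>2" for x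
  proof -
    have "(cmod (f x + g x))\<^sup>2 \<le> (cmod (f x) + cmod (g x))\<^sup>2"
      by (simp add: norm_triangle_ineq power_mono)
    also have "\<dots> \<le> 2 * (cmod (f x))\<^sup>2 + 2 * (cmod (g x))\<^sup>2"
      using zero_le_power2[of "cmod (f x) - cmod (g x)"] by (simp add: power2_eq_square algebra_simps)
    finally show ?thesis .
  qed
  then have "integrable M (\<lambda>x. (cmod (f x + g x))\<^sup>2)"
    using assms
    by (intro Bochner_Integration.integrable_bound[of M "\<lambda>x. 2 * (cmod (f x))\<^sup>2 + 2 * (cmod (g x))\<^sup>2"
         "\<lambda>x. (cmod (f x + g x))\<^sup>2"])
      (auto simp: L2_integrable_square)
  then show ?thesis by (simp add: L2_space_def)
qed

lemma L2_diff:
  assumes "f \<in> L2_space M" "g \<in> L2_space M"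
  shows "(\<lambda>x. f x - g x) \<in> L2_space M"
  using L2_add[OF assms(1) L2_cmult[OF assms(2), of "-1"]] by simp

lemma L2_zero: "(\<lambda>x. 0) \<in> L2_space M"
  by (simp add: L2_space_def)

lemma L2_sum:
  assumes "\<And>i. i \<in> I \<Longrightarrow> f i \<in> L2_space M"
  shows "(\<lambda>x. \<Sum>i\<in>I. f i x) \<in> L2_space M"
proof (cases "finite I")
  case True
  then show ?thesis using assms
    by (induction I rule: finite_induct) (auto intro: L2_add L2_zero)
qed (simp add: L2_zero)

lemma L2_mult_integrable:
  assumes "f \<in> L2_space M" "g \<in> L2_space M"
  shows "integrable M (\<lambda>x. f x * g x)"
proof -
  have [measurable]: "f \<in> borel_measurable M" "g \<in> borel_measurable M"
    using assms by (auto dest: L2_measurable)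
  have "cmod (f x * g x) \<le> (cmod (f x))\<^sup>2 + (cmod (g x))\<^sup>2" for x
    using sum_squares_bound[of "cmod (f x)" "cmod (g x)"]
      mult_nonneg_nonneg[OF norm_ge_zero[of "f x"] norm_ge_zero[of "g x"]]
    unfolding norm_mult by linarith
  then show ?thesis
    using assms
    by (intro Bochner_Integration.integrable_bound[of M "\<lambda>x. (cmod (f x))\<^sup>2 + (cmod (g x))\<^sup>2"
         "\<lambda>x. f x * g x"])
      (auto simp: L2_integrable_square)
qed

theorem L2_Cauchy_Schwarz:
  assumes "f \<in> L2_space M" "g \<in> L2_space M"
  shows "(\<integral>x. cmod (f x) * cmod (g x) \<partial>M) \<le> L2_norm M f * L2_norm M g"
proof -
  have [measurable]: "f \<in> borel_measurable M" "g \<in> borel_measurable M"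
    using assms by (auto dest: L2_measurable)
  have i: "integrable M (\<lambda>x. cmod (f x) * cmod (g x))"
    using integrable_norm[OF L2_mult_integrable[OF assms]] by (simp add: norm_mult)
  let ?b = "\<integral>x. cmod (f x) * cmod (g x) \<partial>M"
  have eq: "(\<integral>\<^sup>+x. (ennreal (cmod (h x)))\<^sup>2 \<partial>M) = ennreal ((L2_norm M h)\<^sup>2)"
    if "h \<in> L2_space M" for h
    using that unfolding L2_norm_square
    by (subst nn_integral_eq_integral[symmetric]) (auto simp: L2_integrable_square ennreal_power)
  have "(\<integral>\<^sup>+x. ennreal (cmod (f x)) * ennreal (cmod (g x)) \<partial>M)\<^sup>2
      \<le> (\<integral>\<^sup>+x. (ennreal (cmod (f x)))\<^sup>2 \<partial>M) * (\<integral>\<^sup>+x. (ennreal (cmod (g x)))\<^sup>2 \<partial>M)"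
    by (rule Cauchy_Schwarz_nn_integral) auto
  moreover have "(\<integral>\<^sup>+x. ennreal (cmod (f x)) * ennreal (cmod (g x)) \<partial>M) = ennreal ?b"
    using i by (subst nn_integral_eq_integral[symmetric]) (auto simp: ennreal_mult)
  ultimately have "ennreal (?b\<^sup>2) \<le> ennreal ((L2_norm M f * L2_norm M g)\<^sup>2)"
    unfolding eq[OF assms(1)] eq[OF assms(2)]
    by (simp add: ennreal_power ennreal_mult'[symmetric] power_mult_distrib)
  then have "?b\<^sup>2 \<le> (L2_norm M f * L2_norm M g)\<^sup>2"
    by (simp add: ennreal_le_iff)
  then show ?thesis
    by (rule power2_le_imp_le) simp
qed

corollary L2_norm_integral_mult_le:
  assumes "f \<in> L2_space M" "g \<in> L2_space M"
  shows "cmod (\<integral>x. f x * g x \<partial>M) \<le> L2_norm M f * L2_norm M g"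
  using L2_Cauchy_Schwarz[OF assms] integral_norm_bound[of M "\<lambda>x. f x * g x"]
  by (simp add: norm_mult)

lemma L2_norm_cmult: "L2_norm M (\<lambda>x. c * f x) = cmod c * L2_norm M f"
  by (simp add: L2_norm_def norm_mult power_mult_distrib real_sqrt_mult)

lemma L2_norm_cnj: "L2_norm M (\<lambda>x. cnj (f x)) = L2_norm M f"
  by (simp add: L2_norm_def)

text \<open>Only a semi-inner product: functions that vanish almost everywhere are not identified with
  zero, so equality in \<open>L\<^sup>2\<close> is expressed by \<open>L2_norm M (\<lambda>x. f x - g x) = 0\<close>.\<close>
definition L2_inner :: "'a measure \<Rightarrow> ('a \<Rightarrow> complex) \<Rightarrow> ('a \<Rightarrow> complex) \<Rightarrow> complex" where
  "L2_inner M f g = (\<integral>x. f x * cnj (g x) \<partial>M)"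

lemma L2_inner_integrable:
  "f \<in> L2_space M \<Longrightarrow> g \<in> L2_space M \<Longrightarrow> integrable M (\<lambda>x. f x * cnj (g x))"
  by (intro L2_mult_integrable L2_cnj)

lemma L2_inner_bound:
  assumes "f \<in> L2_space M" "g \<in> L2_space M"
  shows "cmod (L2_inner M f g) \<le> L2_norm M f * L2_norm M g"
  using L2_norm_integral_mult_le[OF assms(1) L2_cnj[OF assms(2)]]
  by (simp add: L2_inner_def L2_norm_cnj)

lemma L2_inner_null:
  assumes "f \<in> L2_space M" "g \<in> L2_space M" "L2_norm M f = 0"
  shows "L2_inner M f g = 0"
  using L2_inner_bound[OF assms(1,2)] assms(3) by simp

lemma L2_inner_self: "L2_inner M f f = of_real ((L2_norm M f)\<^sup>2)"
  unfolding L2_inner_def L2_norm_square complex_norm_square[symmetric]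
  by (simp flip: integral_complex_of_real)

lemma L2_inner_commute: "L2_inner M g f = cnj (L2_inner M f g)"
  by (simp add: L2_inner_def mult.commute flip: Bochner_Integration.integral_cnj)

lemma L2_inner_cmult_left: "L2_inner M (\<lambda>x. c * f x) g = c * L2_inner M f g"
  by (simp add: L2_inner_def mult.assoc)

lemma L2_inner_cmult_right: "L2_inner M f (\<lambda>x. c * g x) = cnj c * L2_inner M f g"
  by (simp add: L2_inner_def mult.left_commute)

lemma L2_inner_diff_left:
  assumes "f \<in> L2_space M" "g \<in> L2_space M" "h \<in> L2_space M"
  shows "L2_inner M (\<lambda>x. f x - g x) h = L2_inner M f h - L2_inner M g h"
  using assms by (simp add: L2_inner_def left_diff_distrib L2_inner_integrable)

lemma L2_inner_sum_left:
  assumes "\<And>i. i \<in> I \<Longrightarrow> f i \<in> L2_space M" "h \<in> L2_space M"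
  shows "L2_inner M (\<lambda>x. \<Sum>i\<in>I. f i x) h = (\<Sum>i\<in>I. L2_inner M (f i) h)"
  using assms unfolding L2_inner_def sum_distrib_right
  by (intro Bochner_Integration.integral_sum L2_inner_integrable)

lemma L2_inner_diff_right:
  assumes "f \<in> L2_space M" "g \<in> L2_space M" "h \<in> L2_space M"
  shows "L2_inner M h (\<lambda>x. f x - g x) = L2_inner M h f - L2_inner M h g"
  using L2_inner_diff_left[OF assms] by (metis L2_inner_commute complex_cnj_diff)

lemma L2_norm_diff_square:
  assumes "f \<in> L2_space M" "g \<in> L2_space M"
  shows "(L2_norm M (\<lambda>x. f x - g x))\<^sup>2
       = (L2_norm M f)\<^sup>2 - 2 * Re (L2_inner M f g) + (L2_norm M g)\<^sup>2"
proof -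
  have "L2_inner M (\<lambda>x. f x - g x) (\<lambda>x. f x - g x)
      = L2_inner M f f - L2_inner M f g - (cnj (L2_inner M f g) - L2_inner M g g)"
    using assms by (simp add: L2_inner_diff_left L2_inner_diff_right L2_diff
        L2_inner_commute[of M g f])
  from arg_cong[OF this, of Re] show ?thesis
    by (simp add: L2_inner_self)
qed

text \<open>A substitute for the triangle inequality that stays within integrals of squares and is
  sufficient for limits.\<close>
lemma L2_norm_diff_square_le:
  assumes "f \<in> L2_space M" "g \<in> L2_space M" "h \<in> L2_space M"
  shows "(L2_norm M (\<lambda>x. f x - h x))\<^sup>2
       \<le> 2 * (L2_norm M (\<lambda>x. f x - g x))\<^sup>2 + 2 * (L2_norm M (\<lambda>x. g x - h x))\<^sup>2"
proof -
  have "(cmod (f x - h x))\<^sup>2 \<le> 2 * (cmod (f x - g x))\<^sup>2 + 2 * (cmod (g x - h x))\<^sup>2" for x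
  proof -
    have "(cmod (f x - h x))\<^sup>2 \<le> (cmod (f x - g x) + cmod (g x - h x))\<^sup>2"
      by (intro power_mono) (use dist_triangle[of "f x" "h x" "g x"] in \<open>auto simp: dist_norm\<close>)
    also have "\<dots> \<le> 2 * (cmod (f x - g x))\<^sup>2 + 2 * (cmod (g x - h x))\<^sup>2"
      using zero_le_power2[of "cmod (f x - g x) - cmod (g x - h x)"]
      by (simp add: power2_eq_square algebra_simps)
    finally show ?thesis .
  qed
  then have "(\<integral>x. (cmod (f x - h x))\<^sup>2 \<partial>M)
      \<le> (\<integral>x. 2 * (cmod (f x - g x))\<^sup>2 + 2 * (cmod (g x - h x))\<^sup>2 \<partial>M)"
    using assms by (intro integral_mono) (auto simp: L2_integrable_square L2_diff)
  then show ?thesis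
    using assms by (simp add: L2_norm_square L2_integrable_square L2_diff)
qed

lemma (in finite_measure) L2_bounded:
  assumes "f \<in> borel_measurable M" "\<And>x. cmod (f x) \<le> B"
  shows "f \<in> L2_space M"
proof (rule L2_space_dominated[OF assms(1)])
  show "(\<lambda>_. 1) \<in> L2_space M" by (simp add: L2_space_def)
  show "cmod (f x) \<le> B * cmod 1" for x using assms(2) by simp
qed

lemma (in finite_measure) L2_integrable:
  assumes "f \<in> L2_space M"
  shows "integrable M f"
  using L2_mult_integrable[OF assms, of "\<lambda>_. 1"] by (simp add: L2_space_def)

lemma (in finite_measure) L2_norm_tendsto_bounded:
  assumes "\<And>n. F n \<in> borel_measurable M" "\<And>n x. cmod (F n x) \<le> B"
    and "\<And>x. (\<lambda>n. F n x) \<longlonglongrightarrow> v x"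
  shows "(\<lambda>n. L2_norm M (\<lambda>x. F n x - v x)) \<longlonglongrightarrow> 0"
proof -
  note [measurable] = assms(1)
  have [measurable]: "v \<in> borel_measurable M"
    by (rule borel_measurable_LIMSEQ_metric[OF assms(1,3)])
  have vB: "cmod (v x) \<le> B" for x
    by (rule Lim_bounded[OF tendsto_norm[OF assms(3)[of x]], of 0]) (use assms(2) in auto)
  have "(\<lambda>n. \<integral>x. (cmod (F n x - v x))\<^sup>2 \<partial>M) \<longlonglongrightarrow> (\<integral>x. 0 \<partial>M)"
  proof (rule integral_dominated_convergence[where w = "\<lambda>_. (B + B)\<^sup>2"])
    show "AE x in M. (\<lambda>n. (cmod (F n x - v x))\<^sup>2) \<longlonglongrightarrow> 0"
    proof (rule AE_I2)
      fix x
      have "(\<lambda>n. (cmod (F n x - v x))\<^sup>2) \<longlonglongrightarrow> (cmod (v x - v x))\<^sup>2"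
        by (intro tendsto_intros assms(3))
      then show "(\<lambda>n. (cmod (F n x - v x))\<^sup>2) \<longlonglongrightarrow> 0" by simp
    qed
    show "AE x in M. norm ((cmod (F n x - v x))\<^sup>2) \<le> (B + B)\<^sup>2" for n
    proof (rule AE_I2)
      fix x
      have "cmod (F n x - v x) \<le> B + B"
        by (intro order.trans[OF norm_triangle_ineq4] add_mono assms(2) vB)
      from power_mono[OF this norm_ge_zero, of 2]
      show "norm ((cmod (F n x - v x))\<^sup>2) \<le> (B + B)\<^sup>2"
        unfolding real_norm_def by (metis abs_power2)
    qed
  qed auto
  then have "(\<lambda>n. sqrt (\<integral>x. (cmod (F n x - v x))\<^sup>2 \<partial>M)) \<longlonglongrightarrow> sqrt 0"
    by (intro tendsto_real_sqrt) simp
  then show ?thesis by (simp add: L2_norm_def)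
qed

section \<open>Orthonormal systems\<close>

definition orthonormal_system :: "'a measure \<Rightarrow> nat \<Rightarrow> (nat \<Rightarrow> 'a \<Rightarrow> complex) \<Rightarrow> bool" where
  "orthonormal_system M k e \<longleftrightarrow> (\<forall>i<k. e i \<in> L2_space M) \<and>
     (\<forall>i<k. \<forall>j<k. L2_inner M (e i) (e j) = (if i = j then 1 else 0))"

lemma orthogonal_residual:
  assumes e: "orthonormal_system M k e" and f: "f \<in> L2_space M" and "j < k"
  shows "L2_inner M (\<lambda>x. f x - (\<Sum>i<k. L2_inner M f (e i) * e i x)) (e j) = 0"
proof -
  have "L2_inner M (\<lambda>x. \<Sum>i<k. L2_inner M f (e i) * e i x) (e j)
      = (\<Sum>i<k. L2_inner M f (e i) * L2_inner M (e i) (e j))"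
    using e \<open>j < k\<close> unfolding orthonormal_system_def
    by (subst L2_inner_sum_left) (auto simp: L2_cmult L2_inner_cmult_left)
  also have "\<dots> = (\<Sum>i<k. if i = j then L2_inner M f (e j) else 0)"
    using e \<open>j < k\<close> unfolding orthonormal_system_def by (intro sum.cong) auto
  also have "\<dots> = L2_inner M f (e j)"
    using \<open>j < k\<close> by simp
  finally show ?thesis
    using e f \<open>j < k\<close> unfolding orthonormal_system_def
    by (subst L2_inner_diff_left) (auto intro!: L2_sum L2_cmult)
qed

text \<open>The projection \<open>p\<close> of \<open>f\<close> onto the system is orthogonal to \<open>f - p\<close>, so the sum on
  the left is both \<open>\<parallel>p\<parallel>\<^sup>2\<close> and the inner product of \<open>p\<close> and \<open>f\<close>; expanding
  \<open>0 \<le> \<parallel>p - f\<parallel>\<^sup>2\<close> gives the inequality.\<close>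
lemma Bessel_inequality:
  assumes e: "orthonormal_system M k e" and f: "f \<in> L2_space M"
  shows "(\<Sum>i<k. (cmod (L2_inner M f (e i)))\<^sup>2) \<le> (L2_norm M f)\<^sup>2"
proof -
  define p where "p = (\<lambda>x. \<Sum>i<k. L2_inner M f (e i) * e i x)"
  let ?w = "\<lambda>x. f x - p x"
  have eL: "e i \<in> L2_space M" if "i < k" for i
    using e that by (auto simp: orthonormal_system_def)
  have p: "p \<in> L2_space M"
    unfolding p_def by (intro L2_sum L2_cmult) (auto simp: eL)
  have inner_p: "L2_inner M p g = (\<Sum>i<k. L2_inner M f (e i) * L2_inner M (e i) g)"
    if "g \<in> L2_space M" for g
    unfolding p_def using that by (subst L2_inner_sum_left) (auto simp: L2_cmult L2_inner_cmult_left eL)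
  have "L2_inner M p ?w = (\<Sum>i<k. L2_inner M f (e i) * cnj (L2_inner M ?w (e i)))"
    using inner_p[OF L2_diff[OF f p]] by (simp add: L2_inner_commute[of M "e _" ?w])
  also have "\<dots> = 0"
    using orthogonal_residual[OF e f] by (simp add: p_def)
  finally have pp: "L2_inner M p p = L2_inner M p f"
    by (simp add: L2_inner_diff_right f p)
  have pf: "L2_inner M p f = of_real (\<Sum>i<k. (cmod (L2_inner M f (e i)))\<^sup>2)"
    unfolding inner_p[OF f] of_real_sum
    by (intro sum.cong refl)
       (simp add: complex_norm_square L2_inner_commute[of M "e _" f] del: of_real_power)
  have "0 \<le> (L2_norm M (\<lambda>x. p x - f x))\<^sup>2" by simp
  also have "\<dots> = (L2_norm M p)\<^sup>2 - 2 * Re (L2_inner M p f) + (L2_norm M f)\<^sup>2"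
    by (rule L2_norm_diff_square[OF p f])
  also have "(L2_norm M p)\<^sup>2 = Re (L2_inner M p f)"
    using arg_cong[OF pp, of Re] by (simp add: L2_inner_self)
  finally show ?thesis by (simp add: pf)
qed

lemma orthonormal_system_extend:
  assumes e: "orthonormal_system M k e" and w: "w \<in> L2_space M" "L2_norm M w = 1"
    and orth: "\<And>i. i < k \<Longrightarrow> L2_inner M w (e i) = 0"
  shows "orthonormal_system M (Suc k) (e(k := w))"
proof -
  have "L2_inner M (e i) w = 0" if "i < k" for i
    using orth[OF that] L2_inner_commute[of M "e i" w] by simp
  then show ?thesis
    using e w orth unfolding orthonormal_system_def
    by (auto simp: less_Suc_eq L2_inner_self)
qed

text \<open>Finite dimension enters only as a bound on the size of orthonormal systems. A system of
  maximal size is complete, because otherwise the normalized residual of some \<open>u\<close> would extend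
  it.\<close>
lemma exists_complete_orthonormal_system:
  assumes sub: "E \<subseteq> L2_space M"
    and cmult: "\<And>c u. u \<in> E \<Longrightarrow> (\<lambda>x. c * u x) \<in> E"
    and diff: "\<And>u w. u \<in> E \<Longrightarrow> w \<in> E \<Longrightarrow> (\<lambda>x. u x - w x) \<in> E"
    and bounded: "\<And>k e. orthonormal_system M k e \<Longrightarrow> (\<And>i. i < k \<Longrightarrow> e i \<in> E) \<Longrightarrow> k \<le> B"
  obtains d e where "orthonormal_system M d e" "\<And>i. i < d \<Longrightarrow> e i \<in> E"
    "\<And>u. u \<in> E \<Longrightarrow> L2_norm M (\<lambda>x. u x - (\<Sum>i<d. L2_inner M u (e i) * e i x)) = 0"
proof -
  define S where "S = {k. \<exists>e. orthonormal_system M k e \<and> (\<forall>i<k. e i \<in> E)}"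
  have S: "0 \<in> S" "\<And>k. k \<in> S \<Longrightarrow> k \<le> B"
    using bounded by (auto simp: S_def orthonormal_system_def)
  then have "finite S" by (auto intro: finite_subset[of S "{..B}"])
  define d where "d = Max S"
  have "d \<in> S" using S(1) \<open>finite S\<close> unfolding d_def by (intro Max_in) auto
  then obtain e where e: "orthonormal_system M d e" "\<And>i. i < d \<Longrightarrow> e i \<in> E"
    by (auto simp: S_def)
  have "L2_norm M (\<lambda>x. u x - (\<Sum>i<d. L2_inner M u (e i) * e i x)) = 0" (is "L2_norm M ?w = 0")
    if u: "u \<in> E" for u
  proof (rule ccontr)
    assume w0: "L2_norm M ?w \<noteq> 0"
    have "(\<lambda>x. u x - (\<Sum>i<k. L2_inner M u (e i) * e i x)) \<in> E" if "k \<le> d" for k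
      using that
    proof (induction k)
      case (Suc k)
      then have "(\<lambda>x. (u x - (\<Sum>i<k. L2_inner M u (e i) * e i x)) - L2_inner M u (e k) * e k x) \<in> E"
        by (intro diff[OF Suc.IH cmult[OF e(2)]]) auto
      then show ?case by (simp add: diff_diff_eq)
    qed (simp add: u)
    then have wE: "?w \<in> E" by simp
    let ?c = "complex_of_real (1 / L2_norm M ?w)"
    have "orthonormal_system M (Suc d) (e(d := \<lambda>x. ?c * ?w x))"
    proof (rule orthonormal_system_extend[OF e(1)])
      show "(\<lambda>x. ?c * ?w x) \<in> L2_space M" using cmult[OF wE] sub by blast
      show "L2_norm M (\<lambda>x. ?c * ?w x) = 1"
        unfolding L2_norm_cmult using w0 by (simp add: norm_divide)
      show "L2_inner M (\<lambda>x. ?c * ?w x) (e i) = 0" if "i < d" for i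
        unfolding L2_inner_cmult_left using orthogonal_residual[OF e(1) _ that] u sub by auto
    qed
    moreover have "(e(d := \<lambda>x. ?c * ?w x)) i \<in> E" if "i < Suc d" for i
      using that e(2) cmult[OF wE, of ?c] by (auto simp: less_Suc_eq)
    ultimately have "Suc d \<in> S" unfolding S_def by blast
    then show False using Max_ge[OF \<open>finite S\<close>] by (fastforce simp: d_def)
  qed
  with e show thesis by (rule that)
qed

section \<open>Convergent families of measure-preserving maps\<close>

definition preserves_measure :: "'a measure \<Rightarrow> ('a \<Rightarrow> 'a) \<Rightarrow> bool" where
  "preserves_measure M \<phi> \<longleftrightarrow> \<phi> \<in> measurable M M \<and> distr M M \<phi> = M"

lemma preserves_measure_measurable: "preserves_measure M \<phi> \<Longrightarrow> \<phi> \<in> measurable M M"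
  by (simp add: preserves_measure_def)

lemma preserves_measure_comp:
  assumes "preserves_measure M \<phi>" "preserves_measure M \<psi>"
  shows "preserves_measure M (\<lambda>x. \<phi> (\<psi> x))"
  using assms distr_distr[of \<phi> M M \<psi> M] unfolding preserves_measure_def comp_def
  by (auto intro: measurable_compose)

lemma integrable_preserved:
  fixes F :: "'a \<Rightarrow> 'b::{banach, second_countable_topology}"
  assumes "preserves_measure M \<phi>" "integrable M F"
  shows "integrable M (\<lambda>x. F (\<phi> x))"
  using assms integrable_distr_eq[of \<phi> M M F] by (auto simp: preserves_measure_def)

lemma integral_preserved:
  fixes F :: "'a \<Rightarrow> 'b::{banach, second_countable_topology}"
  assumes "preserves_measure M \<phi>" "F \<in> borel_measurable M"
  shows "(\<integral>x. F (\<phi> x) \<partial>M) = (\<integral>x. F x \<partial>M)"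
  using assms integral_distr[of \<phi> M M F] by (auto simp: preserves_measure_def)

lemma L2_preserved:
  assumes "preserves_measure M \<phi>" "f \<in> L2_space M"
  shows "(\<lambda>x. f (\<phi> x)) \<in> L2_space M"
  using integrable_preserved[OF assms(1) L2_integrable_square[OF assms(2)]]
    measurable_compose[OF preserves_measure_measurable[OF assms(1)] L2_measurable[OF assms(2)]]
  by (simp add: L2_space_def)

lemma L2_norm_preserved:
  assumes "preserves_measure M \<phi>" "f \<in> L2_space M"
  shows "L2_norm M (\<lambda>x. f (\<phi> x)) = L2_norm M f"
  using integral_preserved[OF assms(1), of "\<lambda>x. (cmod (f x))\<^sup>2"] L2_integrable_square[OF assms(2)]
  by (simp add: L2_norm_def)

text \<open>The aim is that \<open>F \<circ> \<phi> n\<close> tends to \<open>F \<circ> \<psi>\<close> in \<open>L\<^sup>1\<close> and \<open>L\<^sup>2\<close> for every \<open>F\<close>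
  in these spaces. Such an \<open>F\<close> need not have any point of continuity; measure preservation is
  what makes the pointwise convergence of the maps sufficient. Translations and the reflections
  \<open>y \<mapsto> x - y\<close> of a group are instances.\<close>
locale measure_preserving_limit = finite_measure M
  for M :: "'a::topological_space measure" +
  fixes \<phi> :: "nat \<Rightarrow> 'a \<Rightarrow> 'a" and \<psi> :: "'a \<Rightarrow> 'a"
  assumes sets_M: "sets M = sets borel"
    and preserving: "\<And>n. preserves_measure M (\<phi> n)" "preserves_measure M \<psi>"
    and pointwise: "\<And>x. (\<lambda>n. \<phi> n x) \<longlonglongrightarrow> \<psi> x"
begin

lemma measurable_maps [measurable]: "\<phi> n \<in> measurable M M" "\<psi> \<in> measurable M M"
  by (simp_all add: preserving preserves_measure_measurable)

lemma space_M: "space M = UNIV"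
  using sets_eq_imp_space_eq[OF sets_M] by simp

lemmas integrable_comp = preserving[THEN integrable_preserved]

definition continuous_along :: "('a \<Rightarrow> 'b::{banach, second_countable_topology}) \<Rightarrow> bool" where
  "continuous_along F \<longleftrightarrow> integrable M F \<and>
     (\<lambda>n. \<integral>x. norm (F (\<phi> n x) - F (\<psi> x)) \<partial>M) \<longlonglongrightarrow> 0"

lemma continuous_along_add:
  assumes "continuous_along F" "continuous_along G"
  shows "continuous_along (\<lambda>x. F x + G x)"
proof -
  have i: "integrable M F" "integrable M G"
    using assms by (auto simp: continuous_along_def)
  note [simp] = i[THEN integrable_comp(1)] i[THEN integrable_comp(2)]
  have "(\<lambda>n. \<integral>x. norm ((F (\<phi> n x) + G (\<phi> n x)) - (F (\<psi> x) + G (\<psi> x))) \<partial>M) \<longlonglongrightarrow> 0"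
  proof (rule tendsto_sandwich[OF _ _ tendsto_const])
    show "(\<lambda>n. (\<integral>x. norm (F (\<phi> n x) - F (\<psi> x)) \<partial>M) + (\<integral>x. norm (G (\<phi> n x) - G (\<psi> x)) \<partial>M)) \<longlonglongrightarrow> 0"
      using assms by (intro tendsto_add_zero) (simp_all add: continuous_along_def)
    have "(\<integral>x. norm ((F (\<phi> n x) + G (\<phi> n x)) - (F (\<psi> x) + G (\<psi> x))) \<partial>M)
        \<le> (\<integral>x. norm (F (\<phi> n x) - F (\<psi> x)) + norm (G (\<phi> n x) - G (\<psi> x)) \<partial>M)" for n
      by (intro integral_mono) (auto simp: norm_diff_triangle_ineq)
    then show "\<forall>\<^sub>F n in sequentially. (\<integral>x. norm ((F (\<phi> n x) + G (\<phi> n x)) - (F (\<psi> x) + G (\<psi> x))) \<partial>M)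
        \<le> (\<integral>x. norm (F (\<phi> n x) - F (\<psi> x)) \<partial>M) + (\<integral>x. norm (G (\<phi> n x) - G (\<psi> x)) \<partial>M)"
      by simp
  qed simp
  then show ?thesis using i by (simp add: continuous_along_def)
qed

lemma continuous_along_sum:
  fixes F :: "'i \<Rightarrow> 'a \<Rightarrow> 'b::{banach, second_countable_topology}"
  assumes "\<And>i. i \<in> I \<Longrightarrow> continuous_along (F i)"
  shows "continuous_along (\<lambda>x. \<Sum>i\<in>I. F i x)"
proof -
  have zero: "continuous_along (\<lambda>x. 0 :: 'b)" by (simp add: continuous_along_def)
  show ?thesis
  proof (cases "finite I")
    case True
    then show ?thesis using assms
      by (induction I rule: finite_induct) (auto intro: continuous_along_add zero)
  qed (simp add: zero)
qed

lemma continuous_along_limit: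
  assumes F: "integrable M F" and G: "\<And>k::nat. continuous_along (G k)"
    and lim: "(\<lambda>k. \<integral>x. norm (F x - G k x) \<partial>M) \<longlonglongrightarrow> 0"
  shows "continuous_along F"
proof -
  have i: "integrable M (G k)" for k
    using G by (auto simp: continuous_along_def)
  have [measurable]: "F \<in> borel_measurable M" "G k \<in> borel_measurable M" for k
    using F i by auto
  note [simp] = i i[THEN integrable_comp(1)] i[THEN integrable_comp(2)]
    F F[THEN integrable_comp(1)] F[THEN integrable_comp(2)]
  have "(\<lambda>n. \<integral>x. norm (F (\<phi> n x) - F (\<psi> x)) \<partial>M) \<longlonglongrightarrow> 0"
  proof (rule LIMSEQ_I)
    fix r :: real assume "0 < r"
    then obtain k where "norm ((\<integral>x. norm (F x - G k x) \<partial>M) - 0) < r / 3"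
      using LIMSEQ_D[OF lim, of "r / 3"] by auto
    then have k: "(\<integral>x. norm (F x - G k x) \<partial>M) < r / 3" by simp
    obtain N where "\<forall>n\<ge>N. norm ((\<integral>x. norm (G k (\<phi> n x) - G k (\<psi> x)) \<partial>M) - 0) < r / 3"
      using LIMSEQ_D[of "\<lambda>n. \<integral>x. norm (G k (\<phi> n x) - G k (\<psi> x)) \<partial>M" 0 "r / 3"] G[of k] \<open>0 < r\<close>
      unfolding continuous_along_def by auto
    then have N: "(\<integral>x. norm (G k (\<phi> n x) - G k (\<psi> x)) \<partial>M) < r / 3" if "n \<ge> N" for n
      using that by simp
    have "(\<integral>x. norm (F (\<phi> n x) - F (\<psi> x)) \<partial>M) < r" if "n \<ge> N" for n
    proof -
      have tri: "norm (a - d) \<le> norm (a - b) + norm (b - c) + norm (d - c)" for a b c d :: 'b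
        using norm_triangle_ineq[of "a - b" "b - c"] norm_triangle_ineq[of "a - c" "c - d"]
        by (simp add: norm_minus_commute)
      have "(\<integral>x. norm (F (\<phi> n x) - F (\<psi> x)) \<partial>M) \<le>
          (\<integral>x. norm (F (\<phi> n x) - G k (\<phi> n x)) + norm (G k (\<phi> n x) - G k (\<psi> x))
             + norm (F (\<psi> x) - G k (\<psi> x)) \<partial>M)"
        by (intro integral_mono tri) auto
      also have "\<dots> = (\<integral>x. norm (F (\<phi> n x) - G k (\<phi> n x)) \<partial>M)
          + (\<integral>x. norm (G k (\<phi> n x) - G k (\<psi> x)) \<partial>M) + (\<integral>x. norm (F (\<psi> x) - G k (\<psi> x)) \<partial>M)"
        by simp
      also have "\<dots> < r / 3 + r / 3 + r / 3"
        using k N[OF that] integral_preserved[OF preserving(1), of "\<lambda>x. norm (F x - G k x)" n]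
          integral_preserved[OF preserving(2), of "\<lambda>x. norm (F x - G k x)"]
        by simp
      finally show ?thesis by simp
    qed
    then show "\<exists>no. \<forall>n\<ge>no. norm ((\<integral>x. norm (F (\<phi> n x) - F (\<psi> x)) \<partial>M) - 0) < r"
      by (intro exI[of _ N]) auto
  qed
  then show ?thesis using F by (simp add: continuous_along_def)
qed

text \<open>If \<open>\<psi> x\<close> lies in the open set \<open>U\<close> then so does \<open>\<phi> n x\<close> for large \<open>n\<close>; hence the
  positive part of \<open>indicator U (\<psi> x) - indicator U (\<phi> n x)\<close> tends to \<open>0\<close>. This difference
  has integral \<open>0\<close> since both maps preserve the measure, so its negative part has the same
  integral as its positive part and tends to \<open>0\<close> in \<open>L\<^sup>1\<close> as well.\<close>
lemma continuous_along_indicator_open: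
  assumes U: "open U"
  shows "continuous_along (indicator U :: 'a \<Rightarrow> real)"
proof -
  have [measurable]: "U \<in> sets M" using U sets_M by simp
  have iU: "integrable M (indicator U :: 'a \<Rightarrow> real)"
    by (intro integrable_real_indicator) (auto simp: less_top[symmetric])
  let ?a = "\<lambda>n x. indicator U (\<phi> n x) :: real" and ?b = "\<lambda>x. indicator U (\<psi> x) :: real"
  note [simp] = iU[THEN integrable_comp(1)] iU[THEN integrable_comp(2)]
  have "(\<lambda>n. \<integral>x. max 0 (?b x - ?a n x) \<partial>M) \<longlonglongrightarrow> (\<integral>x. 0 \<partial>M)"
  proof (rule integral_dominated_convergence[where w = "\<lambda>_. 1"])
    show "AE x in M. (\<lambda>n. max 0 (?b x - ?a n x)) \<longlonglongrightarrow> 0"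
    proof (rule AE_I2)
      fix x
      show "(\<lambda>n. max 0 (?b x - ?a n x)) \<longlonglongrightarrow> 0"
      proof (cases "\<psi> x \<in> U")
        case True
        from topological_tendstoD[OF pointwise U True]
        have "\<forall>\<^sub>F n in sequentially. max 0 (?b x - ?a n x) = 0"
          by eventually_elim auto
        then show ?thesis by (rule tendsto_eventually)
      next
        case False
        then show ?thesis by (simp add: indicator_def)
      qed
    qed
  qed (auto simp: indicator_def)
  then have "(\<lambda>n. 2 * (\<integral>x. max 0 (?b x - ?a n x) \<partial>M)) \<longlonglongrightarrow> 2 * 0"
    by (intro tendsto_intros) simp
  moreover have "2 * (\<integral>x. max 0 (?b x - ?a n x) \<partial>M) = (\<integral>x. norm (?a n x - ?b x) \<partial>M)" for n
  proof -
    have "(\<integral>x. norm (?a n x - ?b x) \<partial>M) = (\<integral>x. 2 * max 0 (?b x - ?a n x) + (?a n x - ?b x) \<partial>M)"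
      by (intro Bochner_Integration.integral_cong refl) (auto simp: max_def)
    also have "\<dots> = 2 * (\<integral>x. max 0 (?b x - ?a n x) \<partial>M) + ((\<integral>x. ?a n x \<partial>M) - (\<integral>x. ?b x \<partial>M))"
      by (simp del: integral_indicator)
    also have "(\<integral>x. ?a n x \<partial>M) - (\<integral>x. ?b x \<partial>M) = 0"
      using integral_preserved[OF preserving(1), of "indicator U :: 'a \<Rightarrow> real" n]
        integral_preserved[OF preserving(2), of "indicator U :: 'a \<Rightarrow> real"] by simp
    finally show ?thesis by simp
  qed
  ultimately show ?thesis
    using iU by (simp add: continuous_along_def)
qed

lemma continuous_along_indicator:
  assumes "A \<in> sets M"
  shows "continuous_along (indicator A :: 'a \<Rightarrow> real)"
proof -
  have sets_eq: "sets M = sigma_sets UNIV {S. open S}"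
    by (simp add: sets_M borel_def)
  have int: "integrable M (indicator B :: 'a \<Rightarrow> real)" if "B \<in> sets M" for B
    using that by (intro integrable_real_indicator) (auto simp: less_top[symmetric])
  have "Int_stable {S::'a set. open S}" "{S::'a set. open S} \<subseteq> Pow UNIV"
    by (auto simp: Int_stable_def)
  moreover have "A \<in> sigma_sets UNIV {S. open S}"
    using assms by (simp add: sets_eq)
  ultimately show ?thesis
  proof (induction A rule: sigma_sets_induct_disjoint)
    case (basic A)
    then show ?case by (simp add: continuous_along_indicator_open)
  next
    case empty
    then show ?case by (simp add: continuous_along_def)
  next
    case (compl A)
    have "norm (indicator (UNIV - A) y - indicator (UNIV - A) z :: real)
        = norm (indicator A y - indicator A z :: real)" for y z
      by (auto simp: indicator_def)
    then show ?case
      using compl int[of "UNIV - A"] sets.compl_sets[of A M]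
      by (simp add: continuous_along_def sets_eq[symmetric] space_M)
  next
    case (union A)
    have [measurable]: "A i \<in> sets M" for i
      using union by (auto simp: sets_eq[symmetric])
    show ?case
    proof (rule continuous_along_limit)
      show "integrable M (indicator (\<Union> (range A)) :: 'a \<Rightarrow> real)"
        by (rule int) auto
      show "continuous_along (\<lambda>x. \<Sum>i<k. indicator (A i) x :: real)" for k
        by (intro continuous_along_sum union.IH)
      have part: "(\<Sum>i<k. indicator (A i) x) = (indicator (\<Union>i<k. A i) x :: real)" for k x
        using union.hyps(1) by (intro indicator_UN_disjoint[symmetric])
          (auto simp: disjoint_family_on_def)
      have "(\<lambda>k. \<integral>x. norm (indicator (\<Union> (range A)) x - (\<Sum>i<k. indicator (A i) x) :: real) \<partial>M)
          \<longlonglongrightarrow> (\<integral>x. 0 \<partial>M)"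
      proof (rule integral_dominated_convergence[where w = "\<lambda>_. 1"])
        have "(\<lambda>k. norm (indicator (\<Union> (range A)) x - (\<Sum>i<k. indicator (A i) x) :: real)) \<longlonglongrightarrow> 0" for x
          unfolding part
          by (rule tendsto_norm_zero) (use LIMSEQ_indicator_UN[of A x] in \<open>auto intro!: tendsto_eq_intros\<close>)
        then show "AE x in M. (\<lambda>k. norm (indicator (\<Union> (range A)) x - (\<Sum>i<k. indicator (A i) x) :: real)) \<longlonglongrightarrow> 0"
          by simp
        show "AE x in M. norm (norm (indicator (\<Union> (range A)) x - (\<Sum>i<k. indicator (A i) x) :: real)) \<le> 1" for k
          unfolding part by (auto simp: indicator_def)
      qed auto
      then show "(\<lambda>k. \<integral>x. norm (indicator (\<Union> (range A)) x - (\<Sum>i<k. indicator (A i) x) :: real) \<partial>M)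
          \<longlonglongrightarrow> 0"
        by simp
    qed
  qed
qed

theorem L1_continuity:
  fixes F :: "'a \<Rightarrow> 'b::{banach, second_countable_topology}"
  assumes "integrable M F"
  shows "(\<lambda>n. \<integral>x. norm (F (\<phi> n x) - F (\<psi> x)) \<partial>M) \<longlonglongrightarrow> 0"
proof -
  from assms have "continuous_along F"
  proof (induction rule: integrable_induct)
    case (base A c)
    have "(\<lambda>n. norm c * (\<integral>x. norm (indicator A (\<phi> n x) - indicator A (\<psi> x) :: real) \<partial>M)) \<longlonglongrightarrow> norm c * 0"
      using continuous_along_indicator[OF base(1)]
      by (intro tendsto_intros) (simp add: continuous_along_def)
    moreover have "norm (indicator A y *\<^sub>R c - indicator A z *\<^sub>R c)
        = norm c * norm (indicator A y - indicator A z :: real)" for y z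
      by (simp flip: scaleR_diff_left)
    ultimately show ?case
      using base by (simp add: continuous_along_def)
  next
    case (add f g)
    then show ?case by (simp add: continuous_along_add)
  next
    case (lim f s)
    have [measurable]: "f \<in> borel_measurable M" "s i \<in> borel_measurable M" for i
      using lim by auto
    have "(\<lambda>k. \<integral>x. norm (f x - s k x) \<partial>M) \<longlonglongrightarrow> (\<integral>x. 0 \<partial>M)"
    proof (rule integral_dominated_convergence[where w = "\<lambda>x. 3 * norm (f x)"])
      show "AE x in M. (\<lambda>k. norm (f x - s k x)) \<longlonglongrightarrow> 0"
      proof (rule AE_I2)
        fix x assume "x \<in> space M"
        from lim.hyps(2)[OF this] have "(\<lambda>k. norm (f x - s k x)) \<longlonglongrightarrow> norm (f x - f x)"
          by (intro tendsto_intros)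
        then show "(\<lambda>k. norm (f x - s k x)) \<longlonglongrightarrow> 0" by simp
      qed
      show "AE x in M. norm (norm (f x - s k x)) \<le> 3 * norm (f x)" for k
      proof (rule AE_I2)
        fix x assume "x \<in> space M"
        from lim.hyps(3)[OF this, of k] norm_triangle_ineq4[of "f x" "s k x"]
        show "norm (norm (f x - s k x)) \<le> 3 * norm (f x)" by simp
      qed
    qed (use lim.hyps(4) in auto)
    then have "(\<lambda>k. \<integral>x. norm (f x - s k x) \<partial>M) \<longlonglongrightarrow> 0" by simp
    from continuous_along_limit[OF \<open>integrable M f\<close> \<open>\<And>i. continuous_along (s i)\<close> this]
    show ?case .
  qed
  then show ?thesis by (simp add: continuous_along_def)
qed

end

text \<open>Deduces \<open>L\<^sup>2\<close> from \<open>L\<^sup>1\<close> convergence: for square-integrable \<open>f\<close> the function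
  \<open>\<bar>f\<bar> f\<close> is integrable. The inequality is the strong monotonicity of \<open>a \<mapsto> \<bar>a\<bar> a\<close>:
  pairing the difference of the values at \<open>a\<close> and \<open>b\<close> with \<open>a - b\<close> gives at least
  \<open>(\<bar>a\<bar> + \<bar>b\<bar>) \<bar>a - b\<bar>\<^sup>2 / 2\<close>.\<close>
lemma norm_diff_square_le:
  fixes a b :: "'a::real_inner"
  shows "(norm (a - b))\<^sup>2 \<le> 2 * norm (norm a *\<^sub>R a - norm b *\<^sub>R b)"
proof (cases "a = b")
  case False
  define r s where "r = norm a" and "s = norm b"
  have rs: "inner a a = r\<^sup>2" "inner b b = s\<^sup>2" "0 \<le> r" "0 \<le> s"
    by (simp_all add: r_def s_def dot_square_norm)
  have d: "(norm (a - b))\<^sup>2 = r\<^sup>2 + s\<^sup>2 - 2 * inner a b"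
    by (simp add: power2_norm_eq_inner inner_diff_left inner_diff_right rs inner_commute)
  have "2 * inner (r *\<^sub>R a - s *\<^sub>R b) (a - b) = (r + s) * (norm (a - b))\<^sup>2 + (r + s) * (r - s)\<^sup>2"
    unfolding d
    by (simp add: inner_diff_left inner_diff_right rs inner_commute algebra_simps power2_eq_square)
  moreover have "0 \<le> (r + s) * (r - s)\<^sup>2" using rs by simp
  moreover have "norm (a - b) * (norm (a - b))\<^sup>2 \<le> (r + s) * (norm (a - b))\<^sup>2"
    by (intro mult_right_mono) (auto simp: r_def s_def norm_triangle_ineq4)
  moreover have "inner (r *\<^sub>R a - s *\<^sub>R b) (a - b) \<le> norm (r *\<^sub>R a - s *\<^sub>R b) * norm (a - b)"
    by (rule norm_cauchy_schwarz)
  ultimately have "norm (a - b) * (norm (a - b))\<^sup>2 \<le> norm (a - b) * (2 * norm (r *\<^sub>R a - s *\<^sub>R b))"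
    by (simp add: algebra_simps)
  then show ?thesis
    using False by (simp add: r_def s_def)
qed simp

theorem (in measure_preserving_limit) L2_continuity:
  assumes f: "f \<in> L2_space M"
  shows "(\<lambda>n. L2_norm M (\<lambda>x. f (\<phi> n x) - f (\<psi> x))) \<longlonglongrightarrow> 0"
proof -
  let ?F = "\<lambda>x. cmod (f x) *\<^sub>R f x"
  have [measurable]: "f \<in> borel_measurable M" using f by (rule L2_measurable)
  have F: "integrable M ?F"
    by (rule Bochner_Integration.integrable_bound[OF L2_integrable_square[OF f]])
      (auto simp: power2_eq_square)
  note [simp] = F[THEN integrable_comp(1)] F[THEN integrable_comp(2)]
  have "(\<lambda>n. \<integral>x. (cmod (f (\<phi> n x) - f (\<psi> x)))\<^sup>2 \<partial>M) \<longlonglongrightarrow> 0"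
  proof (rule tendsto_sandwich[OF _ _ tendsto_const])
    show "(\<lambda>n. 2 * (\<integral>x. norm (?F (\<phi> n x) - ?F (\<psi> x)) \<partial>M)) \<longlonglongrightarrow> 0"
      using tendsto_mult_left[OF L1_continuity[OF F], of 2] by simp
    have "(\<integral>x. (cmod (f (\<phi> n x) - f (\<psi> x)))\<^sup>2 \<partial>M)
        \<le> (\<integral>x. 2 * norm (?F (\<phi> n x) - ?F (\<psi> x)) \<partial>M)" for n
      by (intro integral_mono norm_diff_square_le L2_integrable_square L2_diff L2_preserved[OF preserving(1)] L2_preserved[OF preserving(2)] f) auto
    then show "\<forall>\<^sub>F n in sequentially. (\<integral>x. (cmod (f (\<phi> n x) - f (\<psi> x)))\<^sup>2 \<partial>M)
        \<le> 2 * (\<integral>x. norm (?F (\<phi> n x) - ?F (\<psi> x)) \<partial>M)"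
      by simp
  qed simp
  from tendsto_real_sqrt[OF this] show ?thesis by (simp add: L2_norm_def)
qed

section \<open>Haar measure\<close>

locale haar_probability =
  fixes \<mu> :: "'a::{topological_group_add, t2_space, second_countable_topology} measure"
  assumes haar: "normalized_haar_measure \<mu>"
begin

lemma sets_haar [measurable_cong]: "sets \<mu> = sets borel"
  using haar by (simp add: normalized_haar_measure_def)

lemma space_haar [simp]: "space \<mu> = UNIV"
  using sets_eq_imp_space_eq[OF sets_haar] by simp

lemma measure_haar [simp]: "emeasure \<mu> UNIV = 1" "measure \<mu> UNIV = 1"
  using haar by (simp_all add: normalized_haar_measure_def measure_def)

sublocale finite_measure \<mu>
  by standard simp

lemma continuous_haar_measurable: "continuous_on UNIV \<phi> \<Longrightarrow> \<phi> \<in> measurable \<mu> \<mu>"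
  using borel_measurable_continuous_onI[of \<phi>]
  by (simp cong: measurable_cong_sets add: sets_haar)

lemma preserves_translation:
  "preserves_measure \<mu> (\<lambda>x. g + x)" "preserves_measure \<mu> (\<lambda>x. x + g)"
  using haar unfolding preserves_measure_def normalized_haar_measure_def
  by (auto intro!: continuous_haar_measurable continuous_intros cong: distr_cong)

text \<open>Second countability is what makes the product of the Borel sigma-algebras the Borel
  sigma-algebra of the product, on which subtraction is continuous.\<close>
lemma measurable_group_diff [measurable]:
  "(\<lambda>(x, y). x - y) \<in> measurable (\<mu> \<Otimes>\<^sub>M \<mu>) \<mu>"
proof -
  have "continuous_on UNIV (\<lambda>p::'a \<times> 'a. fst p + - snd p)"
    by (intro continuous_intros)
  from borel_measurable_continuous_onI[OF this]
  have "(\<lambda>(x, y). x - y) \<in> measurable (borel \<Otimes>\<^sub>M borel :: ('a \<times> 'a) measure) borel"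
    by (simp add: borel_prod case_prod_unfold)
  then show ?thesis
    by (simp cong: measurable_cong_sets sets_pair_measure_cong add: sets_haar)
qed

lemma measurable_diff_comp:
  assumes [measurable]: "F \<in> measurable \<mu> N"
  shows "(\<lambda>p. F (fst p - snd p)) \<in> measurable (\<mu> \<Otimes>\<^sub>M \<mu>) N"
  using measurable_compose[OF measurable_group_diff assms] by (simp add: case_prod_unfold)

text \<open>Integrate \<open>F (y - x)\<close> over both variables. Right translation by \<open>y\<close> in the variable
  \<open>x\<close> turns the integrand into \<open>F (- x)\<close>, and right translation by \<open>x\<close> in the variable
  \<open>y\<close> turns it into \<open>F y\<close>.\<close>
lemma preserves_inversion: "preserves_measure \<mu> (\<lambda>x. - x)"
proof -
  interpret P: pair_sigma_finite \<mu> \<mu> ..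
  have m [measurable]: "(\<lambda>x. - x) \<in> measurable \<mu> \<mu>"
    by (intro continuous_haar_measurable continuous_intros)
  note [measurable] = preserves_translation[THEN preserves_measure_measurable]
  have "emeasure (distr \<mu> \<mu> (\<lambda>x. - x)) A = emeasure \<mu> A" if [measurable]: "A \<in> sets \<mu>" for A
  proof -
    let ?F = "indicator A :: 'a \<Rightarrow> ennreal"
    have translate: "(\<integral>\<^sup>+x. H (x + g) \<partial>\<mu>) = (\<integral>\<^sup>+x. H x \<partial>\<mu>)"
      if [measurable]: "H \<in> borel_measurable \<mu>" for H :: "'a \<Rightarrow> ennreal" and g
      using nn_integral_distr[of "\<lambda>x. x + g" \<mu> \<mu> H] preserves_translation(2)[of g]
      by (simp add: preserves_measure_def)
    have "emeasure (distr \<mu> \<mu> (\<lambda>x. - x)) A = (\<integral>\<^sup>+x. ?F (- x) \<partial>\<mu>)"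
      by (subst nn_integral_distr[OF m, symmetric]) simp_all
    also have "\<dots> = (\<integral>\<^sup>+y. (\<integral>\<^sup>+x. ?F (- x) \<partial>\<mu>) \<partial>\<mu>)"
      by simp
    also have "\<dots> = (\<integral>\<^sup>+y. (\<integral>\<^sup>+x. ?F (y - x) \<partial>\<mu>) \<partial>\<mu>)"
    proof (rule nn_integral_cong)
      fix y
      have "(\<lambda>x. ?F (y - x)) \<in> borel_measurable \<mu>"
        using measurable_diff_comp[of ?F] by measurable
      from translate[OF this, of y] show "(\<integral>\<^sup>+x. ?F (- x) \<partial>\<mu>) = (\<integral>\<^sup>+x. ?F (y - x) \<partial>\<mu>)"
        by (simp add: diff_add_eq_diff_diff_swap)
    qed
    also have "\<dots> = (\<integral>\<^sup>+x. (\<integral>\<^sup>+y. ?F (y - x) \<partial>\<mu>) \<partial>\<mu>)"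
      by (rule P.Fubini') (use measurable_diff_comp[of ?F] in \<open>simp add: case_prod_unfold\<close>)
    also have "\<dots> = (\<integral>\<^sup>+x. (\<integral>\<^sup>+y. ?F y \<partial>\<mu>) \<partial>\<mu>)"
    proof (rule nn_integral_cong)
      fix x
      show "(\<integral>\<^sup>+y. ?F (y - x) \<partial>\<mu>) = (\<integral>\<^sup>+y. ?F y \<partial>\<mu>)"
        using translate[of ?F "- x"] by simp
    qed
    finally show ?thesis by simp
  qed
  then have "distr \<mu> \<mu> (\<lambda>x. - x) = \<mu>"
    by (intro measure_eqI) auto
  then show ?thesis using m by (simp add: preserves_measure_def)
qed

lemma preserves_reflection: "preserves_measure \<mu> (\<lambda>y. x - y)"
  using preserves_measure_comp[OF preserves_translation(1)[of x] preserves_inversion] by simp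

lemma right_translation_L2_continuous:
  assumes "f \<in> L2_space \<mu>" "X \<longlonglongrightarrow> g"
  shows "(\<lambda>n. L2_norm \<mu> (\<lambda>x. f (x + X n) - f (x + g))) \<longlonglongrightarrow> 0"
proof -
  interpret measure_preserving_limit \<mu> "\<lambda>n x. x + X n" "\<lambda>x. x + g"
    by standard (auto intro!: sets_haar preserves_translation tendsto_intros assms(2))
  show ?thesis using L2_continuity[OF assms(1)] .
qed

lemma reflection_L2_continuous:
  assumes "f \<in> L2_space \<mu>" "X \<longlonglongrightarrow> g"
  shows "(\<lambda>n. L2_norm \<mu> (\<lambda>y. f (X n - y) - f (g - y))) \<longlonglongrightarrow> 0"
proof -
  have "(\<lambda>n. X n + - y) \<longlonglongrightarrow> g + - y" for y
    by (intro tendsto_intros assms(2))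
  then interpret measure_preserving_limit \<mu> "\<lambda>n y. X n - y" "\<lambda>y. g - y"
    by unfold_locales (auto intro!: sets_haar preserves_reflection)
  show ?thesis using L2_continuity[OF assms(1)] .
qed

section \<open>Convolution operators\<close>

abbreviation conv :: "('a \<Rightarrow> complex) \<Rightarrow> ('a \<Rightarrow> complex) \<Rightarrow> 'a \<Rightarrow> complex" where
  "conv \<equiv> convolution \<mu>"

lemma convolution_integrable:
  assumes "f \<in> L2_space \<mu>" "h \<in> L2_space \<mu>"
  shows "integrable \<mu> (\<lambda>y. f (x - y) * h y)"
  by (intro L2_mult_integrable L2_preserved[OF preserves_reflection] assms)

lemma convolution_measurable:
  assumes "f \<in> L2_space \<mu>" "h \<in> L2_space \<mu>"
  shows "conv f h \<in> borel_measurable \<mu>"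
proof -
  have [measurable]: "f \<in> borel_measurable \<mu>" "h \<in> borel_measurable \<mu>"
    using assms by (auto dest: L2_measurable)
  have [measurable]: "(\<lambda>p. f (fst p - snd p)) \<in> borel_measurable (\<mu> \<Otimes>\<^sub>M \<mu>)"
    by (rule measurable_diff_comp) simp
  show ?thesis
    unfolding convolution_def
    by (rule borel_measurable_lebesgue_integral) (simp add: case_prod_unfold)
qed

lemma convolution_bound:
  assumes "f \<in> L2_space \<mu>" "h \<in> L2_space \<mu>"
  shows "cmod (conv f h x) \<le> L2_norm \<mu> f * L2_norm \<mu> h"
  using L2_norm_integral_mult_le[OF L2_preserved[OF preserves_reflection[of x] assms(1)] assms(2)]
  by (simp add: convolution_def L2_norm_preserved[OF preserves_reflection assms(1)])

lemma convolution_L2: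
  assumes "f \<in> L2_space \<mu>" "h \<in> L2_space \<mu>"
  shows "conv f h \<in> L2_space \<mu>"
  by (rule L2_bounded[OF convolution_measurable[OF assms] convolution_bound[OF assms]])

lemma convolution_cmult: "conv f (\<lambda>x. c * h x) x = c * conv f h x"
  by (simp add: convolution_def mult.left_commute)

lemma convolution_diff:
  assumes "f \<in> L2_space \<mu>" "g \<in> L2_space \<mu>" "h \<in> L2_space \<mu>"
  shows "conv f (\<lambda>x. g x - h x) x = conv f g x - conv f h x"
  using assms by (simp add: convolution_def right_diff_distrib convolution_integrable)

lemma convolution_translate:
  assumes "f \<in> L2_space \<mu>" "h \<in> L2_space \<mu>"
  shows "conv f (\<lambda>x. h (x + g)) x = conv f h (x + g)"
proof -
  have "(\<integral>y. f (x + g - (y + g)) * h (y + g) \<partial>\<mu>) = (\<integral>y. f (x + g - y) * h y \<partial>\<mu>)"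
    using convolution_integrable[OF assms, of "x + g"]
    by (intro integral_preserved[OF preserves_translation(2)]) auto
  then show ?thesis by (simp add: convolution_def diff_add_eq_diff_diff_swap)
qed

text \<open>The function for which convolution by \<open>adj f\<close> is the adjoint of convolution by \<open>f\<close>
  (\<open>convolution_adjoint\<close>).\<close>
definition adj :: "('a \<Rightarrow> complex) \<Rightarrow> 'a \<Rightarrow> complex" where
  "adj f = (\<lambda>x. cnj (f (- x)))"

lemma adj_L2: "f \<in> L2_space \<mu> \<Longrightarrow> adj f \<in> L2_space \<mu>"
  unfolding adj_def by (intro L2_cnj L2_preserved[OF preserves_inversion])

lemma convolution_adjoint:
  assumes f: "f \<in> L2_space \<mu>" and h: "h \<in> L2_space \<mu>" and w: "w \<in> L2_space \<mu>"
  shows "L2_inner \<mu> (conv f h) w = L2_inner \<mu> h (conv (adj f) w)"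
proof -
  interpret P: pair_sigma_finite \<mu> \<mu> ..
  have [measurable]: "f \<in> borel_measurable \<mu>" "h \<in> borel_measurable \<mu>" "w \<in> borel_measurable \<mu>"
    using assms by (auto dest: L2_measurable)
  have [measurable]: "(\<lambda>p. f (fst p - snd p)) \<in> borel_measurable (\<mu> \<Otimes>\<^sub>M \<mu>)"
    by (rule measurable_diff_comp) simp
  have [measurable]: "(\<lambda>x. cnj (w x)) \<in> borel_measurable \<mu>"
    using L2_cnj[OF w] by (rule L2_measurable)
  let ?F = "\<lambda>x y. f (x - y) * h y * cnj (w x)"
  have int: "integrable (\<mu> \<Otimes>\<^sub>M \<mu>) (\<lambda>(x, y). ?F x y)"
  proof (rule P.Fubini_integrable)
    show meas: "(\<lambda>(x, y). ?F x y) \<in> borel_measurable (\<mu> \<Otimes>\<^sub>M \<mu>)"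
      by (simp add: case_prod_unfold)
    show "AE x in \<mu>. integrable \<mu> (\<lambda>y. case (x, y) of (x, y) \<Rightarrow> ?F x y)"
      using convolution_integrable[OF f h] by simp
    show "integrable \<mu> (\<lambda>x. \<integral>y. norm (case (x, y) of (x, y) \<Rightarrow> ?F x y) \<partial>\<mu>)"
    proof (rule Bochner_Integration.integrable_bound)
      show "integrable \<mu> (\<lambda>x. (L2_norm \<mu> f * L2_norm \<mu> h) * cmod (w x))"
        using L2_integrable[OF w] by simp
      show "(\<lambda>x. \<integral>y. norm (case (x, y) of (x, y) \<Rightarrow> ?F x y) \<partial>\<mu>) \<in> borel_measurable \<mu>"
        using meas by measurable
      have "(\<integral>y. cmod (f (x - y)) * cmod (h y) \<partial>\<mu>) \<le> L2_norm \<mu> f * L2_norm \<mu> h" for x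
        using L2_Cauchy_Schwarz[OF L2_preserved[OF preserves_reflection[of x] f] h]
        by (simp add: L2_norm_preserved[OF preserves_reflection f])
      from mult_right_mono[OF this norm_ge_zero]
      show "AE x in \<mu>. norm (\<integral>y. norm (case (x, y) of (x, y) \<Rightarrow> ?F x y) \<partial>\<mu>)
          \<le> norm ((L2_norm \<mu> f * L2_norm \<mu> h) * cmod (w x))"
        by (intro AE_I2) (simp add: norm_mult abs_mult)
    qed
  qed
  have "L2_inner \<mu> (conv f h) w = (\<integral>x. (\<integral>y. ?F x y \<partial>\<mu>) \<partial>\<mu>)"
    by (simp add: L2_inner_def convolution_def)
  also have "\<dots> = (\<integral>y. (\<integral>x. ?F x y \<partial>\<mu>) \<partial>\<mu>)"
    by (rule P.Fubini_integral[OF int, symmetric])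
  also have "\<dots> = L2_inner \<mu> h (conv (adj f) w)"
    unfolding L2_inner_def convolution_def adj_def
    by (simp add: Bochner_Integration.integral_cnj[symmetric] mult_ac
        flip: Bochner_Integration.integral_mult_right_zero del: Bochner_Integration.integral_cnj)
  finally show ?thesis .
qed

text \<open>The adjoint identity tested against the constant \<open>1\<close>.\<close>
lemma integral_convolution:
  assumes "f \<in> L2_space \<mu>" "h \<in> L2_space \<mu>"
  shows "(\<integral>x. conv f h x \<partial>\<mu>) = (\<integral>x. f x \<partial>\<mu>) * (\<integral>x. h x \<partial>\<mu>)"
proof -
  have one: "(\<lambda>_. 1) \<in> L2_space \<mu>" by (simp add: L2_space_def)
  have "(\<integral>y. cnj (f (- (x - y))) \<partial>\<mu>) = cnj (\<integral>y. f y \<partial>\<mu>)" for x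
    using integral_preserved[OF preserves_measure_comp[OF preserves_inversion preserves_reflection[of x]]
      L2_measurable[OF assms(1)]] by simp
  then show ?thesis
    using convolution_adjoint[OF assms one]
    by (simp add: L2_inner_def convolution_def adj_def)
qed

text \<open>The values \<open>conv f (e i) x\<close> are, up to conjugation, the coefficients of the row
  \<open>y \<mapsto> cnj (f (x - y))\<close> of the kernel in the orthonormal system, and all rows have norm
  \<open>L2_norm \<mu> f\<close>. So Bessel's inequality holds with the same bound at every \<open>x\<close>.\<close>
lemma Hilbert_Schmidt_bound:
  assumes f: "f \<in> L2_space \<mu>" and e: "orthonormal_system \<mu> k e"
  shows "(\<Sum>i<k. (L2_norm \<mu> (conv f (e i)))\<^sup>2) \<le> (L2_norm \<mu> f)\<^sup>2"
proof -
  have eL: "e i \<in> L2_space \<mu>" if "i < k" for i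
    using e that by (auto simp: orthonormal_system_def)
  have pointwise: "(\<Sum>i<k. (cmod (conv f (e i) x))\<^sup>2) \<le> (L2_norm \<mu> f)\<^sup>2" for x
  proof -
    let ?F = "\<lambda>y. cnj (f (x - y))"
    have F: "?F \<in> L2_space \<mu>"
      by (intro L2_cnj L2_preserved[OF preserves_reflection] f)
    have "conv f (e i) x = cnj (L2_inner \<mu> ?F (e i))" for i
      by (simp add: L2_inner_def convolution_def flip: Bochner_Integration.integral_cnj)
    then have "(\<Sum>i<k. (cmod (conv f (e i) x))\<^sup>2) = (\<Sum>i<k. (cmod (L2_inner \<mu> ?F (e i)))\<^sup>2)"
      by simp
    also have "\<dots> \<le> (L2_norm \<mu> ?F)\<^sup>2"
      by (rule Bessel_inequality[OF e F])
    also have "L2_norm \<mu> ?F = L2_norm \<mu> f"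
      by (simp add: L2_norm_cnj L2_norm_preserved[OF preserves_reflection f])
    finally show ?thesis .
  qed
  have int: "integrable \<mu> (\<lambda>x. (cmod (conv f (e i) x))\<^sup>2)" if "i < k" for i
    using that by (intro L2_integrable_square convolution_L2 f eL)
  have "(\<Sum>i<k. (L2_norm \<mu> (conv f (e i)))\<^sup>2) = (\<integral>x. (\<Sum>i<k. (cmod (conv f (e i) x))\<^sup>2) \<partial>\<mu>)"
    using int by (simp add: L2_norm_square Bochner_Integration.integral_sum)
  also have "\<dots> \<le> (\<integral>x. (L2_norm \<mu> f)\<^sup>2 \<partial>\<mu>)"
    using int by (intro integral_mono pointwise) auto
  finally show ?thesis by simp
qed

text \<open>By Cauchy-Schwarz the oscillation of \<open>conv f h\<close> is controlled by the \<open>L\<^sup>2\<close> distance of two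
  reflected translates of \<open>f\<close>, uniformly in \<open>h\<close>.\<close>
lemma convolution_equicontinuous:
  assumes f: "f \<in> L2_space \<mu>" and "0 < e"
  obtains U where "open U" "x \<in> U"
    "\<And>y h. y \<in> U \<Longrightarrow> h \<in> L2_space \<mu> \<Longrightarrow> L2_norm \<mu> h \<le> 1 \<Longrightarrow> cmod (conv f h y - conv f h x) < e"
proof -
  let ?q = "\<lambda>y. L2_norm \<mu> (\<lambda>z. f (y - z) - f (x - z))"
  have "(?q \<longlongrightarrow> 0) (at x)"
    unfolding tendsto_at_iff_sequentially comp_def
    using reflection_L2_continuous[OF f] by blast
  from order_tendstoD(2)[OF this \<open>0 < e\<close>]
  obtain U where U: "open U" "x \<in> U" "\<And>y. y \<in> U \<Longrightarrow> y \<noteq> x \<Longrightarrow> ?q y < e"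
    by (auto simp: eventually_at_topological)
  show thesis
  proof (rule that[OF U(1,2)])
    fix y h assume y: "y \<in> U" and h: "h \<in> L2_space \<mu>" "L2_norm \<mu> h \<le> 1"
    have q: "?q y < e"
      using U(3)[OF y] \<open>0 < e\<close> by (cases "y = x") (auto simp: L2_norm_def)
    have "conv f h y - conv f h x = (\<integral>z. (f (y - z) - f (x - z)) * h z \<partial>\<mu>)"
      using f h by (simp add: convolution_def left_diff_distrib convolution_integrable)
    also have "cmod \<dots> \<le> ?q y * L2_norm \<mu> h"
      by (intro L2_norm_integral_mult_le L2_diff L2_preserved[OF preserves_reflection] f h)
    also have "\<dots> \<le> ?q y"
      using mult_left_mono[OF h(2), of "?q y"] by simp
    finally show "cmod (conv f h y - conv f h x) < e"
      using q by simp
  qed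
qed

text \<open>The Arzela-Ascoli argument on a separable group: a diagonal subsequence converges on a
  countable dense set, and equicontinuity makes it a Cauchy sequence at every point.\<close>
theorem convolution_compact:
  assumes f: "f \<in> L2_space \<mu>"
    and h: "\<And>n::nat. h n \<in> L2_space \<mu>" "\<And>n. L2_norm \<mu> (h n) \<le> 1"
  obtains r :: "nat \<Rightarrow> nat" and v
    where "strict_mono r" "\<And>x. (\<lambda>n. conv f (h (r n)) x) \<longlonglongrightarrow> v x"
proof -
  obtain D :: "'a set" where D: "countable D" "\<And>X. open X \<Longrightarrow> X \<noteq> {} \<Longrightarrow> \<exists>d\<in>D. d \<in> X"
    by (rule countable_dense_setE) blast
  have bound: "cmod (conv f (h n) x) \<le> L2_norm \<mu> f" for n x
    using convolution_bound[OF f h(1)[of n], of x] mult_left_mono[OF h(2)[of n], of "L2_norm \<mu> f"]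
    by simp
  obtain r :: "nat \<Rightarrow> nat" where r: "strict_mono r"
    "\<And>x. x \<in> D \<Longrightarrow> \<exists>l. (\<lambda>n. conv f (h (r n)) x) \<longlonglongrightarrow> l"
    using function_convergent_subsequence[OF D(1), of "\<lambda>n. conv f (h n)"] bound by metis
  have "\<exists>l. (\<lambda>n. conv f (h (r n)) x) \<longlonglongrightarrow> l" for x
  proof -
    have "Cauchy (\<lambda>n. conv f (h (r n)) x)"
    proof (rule metric_CauchyI)
      fix e :: real assume "0 < e"
      then have "0 < e / 3" by simp
      from convolution_equicontinuous[OF f this]
      obtain U where U: "open U" "x \<in> U"
        "\<And>y h. y \<in> U \<Longrightarrow> h \<in> L2_space \<mu> \<Longrightarrow> L2_norm \<mu> h \<le> 1 \<Longrightarrow> cmod (conv f h y - conv f h x) < e / 3"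
        by blast
      obtain d where d: "d \<in> D" "d \<in> U" using D(2)[OF U(1)] U(2) by blast
      let ?a = "\<lambda>n. conv f (h (r n)) d" and ?b = "\<lambda>n. conv f (h (r n)) x"
      have near: "dist (?a n) (?b n) < e / 3" for n
        using U(3)[OF d(2) h(1) h(2)] by (simp add: dist_norm)
      have "Cauchy ?a" using r(2)[OF d(1)] by (auto intro: LIMSEQ_imp_Cauchy)
      from metric_CauchyD[OF this \<open>0 < e / 3\<close>]
      obtain N where N: "\<And>m n. m \<ge> N \<Longrightarrow> n \<ge> N \<Longrightarrow> dist (?a m) (?a n) < e / 3" by blast
      have "dist (?b m) (?b n) < e" if "m \<ge> N" "n \<ge> N" for m n
        using near[of m] near[of n] N[OF that]
          dist_triangle2[of "?b m" "?b n" "?a m"] dist_triangle[of "?b n" "?a m" "?a n"]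
        by (simp add: dist_commute)
      then show "\<exists>M. \<forall>m\<ge>M. \<forall>n\<ge>M. dist (?b m) (?b n) < e" by blast
    qed
    then show ?thesis by (simp add: Cauchy_convergent_iff convergent_def)
  qed
  then obtain v where "\<And>x. (\<lambda>n. conv f (h (r n)) x) \<longlonglongrightarrow> v x" by metis
  with r(1) show thesis by (rule that)
qed

section \<open>An extremal eigenfunction\<close>

lemma L2_norm_convolution_le:
  assumes f: "f \<in> L2_space \<mu>" and h: "h \<in> L2_space \<mu>"
  shows "L2_norm \<mu> (conv f h) \<le> L2_norm \<mu> f * L2_norm \<mu> h"
proof (rule power2_le_imp_le)
  have "(L2_norm \<mu> (conv f h))\<^sup>2 \<le> (\<integral>x. (L2_norm \<mu> f * L2_norm \<mu> h)\<^sup>2 \<partial>\<mu>)"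
    unfolding L2_norm_square
    by (intro integral_mono L2_integrable_square convolution_L2 f h power_mono convolution_bound) auto
  then show "(L2_norm \<mu> (conv f h))\<^sup>2 \<le> (L2_norm \<mu> f * L2_norm \<mu> h)\<^sup>2" by simp
qed simp

lemma L2_norm_integral_le: "f \<in> L2_space \<mu> \<Longrightarrow> cmod (\<integral>x. f x \<partial>\<mu>) \<le> L2_norm \<mu> f"
  using L2_norm_integral_mult_le[of f \<mu> "\<lambda>_. 1"] by (simp add: L2_space_def L2_norm_def)

lemma convolution_adjoint':
  assumes "f \<in> L2_space \<mu>" "h \<in> L2_space \<mu>" "w \<in> L2_space \<mu>"
  shows "L2_inner \<mu> (conv (adj f) w) h = L2_inner \<mu> w (conv f h)"
  using convolution_adjoint[OF assms] by (metis L2_inner_commute)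

definition mean_zero_ball :: "('a \<Rightarrow> complex) set" where
  "mean_zero_ball = {h \<in> L2_space \<mu>. (\<integral>x. h x \<partial>\<mu>) = 0 \<and> L2_norm \<mu> h \<le> 1}"

text \<open>The squared operator norm of convolution by \<open>f\<close> on the functions of mean zero.\<close>
definition conv_gain :: "('a \<Rightarrow> complex) \<Rightarrow> real" where
  "conv_gain f = (SUP h\<in>mean_zero_ball. (L2_norm \<mu> (conv f h))\<^sup>2)"

lemma conv_gain_upper:
  assumes f: "f \<in> L2_space \<mu>"
  shows "h \<in> mean_zero_ball \<Longrightarrow> (L2_norm \<mu> (conv f h))\<^sup>2 \<le> conv_gain f"
  unfolding conv_gain_def
proof (rule cSUP_upper)
  show "bdd_above ((\<lambda>h. (L2_norm \<mu> (conv f h))\<^sup>2) ` mean_zero_ball)"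
  proof (rule bdd_aboveI2)
    fix h assume "h \<in> mean_zero_ball"
    then have h: "h \<in> L2_space \<mu>" "L2_norm \<mu> h \<le> 1" by (auto simp: mean_zero_ball_def)
    have "L2_norm \<mu> (conv f h) \<le> L2_norm \<mu> f"
      using L2_norm_convolution_le[OF f h(1)] mult_left_mono[OF h(2), of "L2_norm \<mu> f"] by simp
    then show "(L2_norm \<mu> (conv f h))\<^sup>2 \<le> (L2_norm \<mu> f)\<^sup>2" by (simp add: power_mono)
  qed
qed

lemma conv_gain_bound:
  assumes f: "f \<in> L2_space \<mu>" and h: "h \<in> L2_space \<mu>" and mean: "(\<integral>x. h x \<partial>\<mu>) = 0"
  shows "(L2_norm \<mu> (conv f h))\<^sup>2 \<le> conv_gain f * (L2_norm \<mu> h)\<^sup>2"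
proof (cases "L2_norm \<mu> h = 0")
  case True
  then show ?thesis using L2_norm_convolution_le[OF f h] L2_norm_nonneg[of \<mu> "conv f h"] by simp
next
  case False
  let ?c = "complex_of_real (1 / L2_norm \<mu> h)"
  have "(\<lambda>x. ?c * h x) \<in> mean_zero_ball"
    using False h mean unfolding mean_zero_ball_def
    by (simp add: L2_cmult L2_norm_cmult norm_divide del: of_real_divide)
  from conv_gain_upper[OF f this]
  have "(L2_norm \<mu> (\<lambda>x. ?c * conv f h x))\<^sup>2 \<le> conv_gain f"
    by (simp only: convolution_cmult[abs_def])
  then have "(L2_norm \<mu> (conv f h))\<^sup>2 / (L2_norm \<mu> h)\<^sup>2 \<le> conv_gain f"
    by (simp add: L2_norm_cmult[of \<mu> ?c] norm_divide power_divide del: of_real_divide)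
  then show ?thesis
    using False by (simp add: pos_divide_le_eq)
qed

text \<open>With \<open>T\<close> for convolution by \<open>f\<close> and \<open>w = T\<^sup>* T h\<close>, the square of \<open>\<parallel>w\<parallel>\<close> is the inner
  product of \<open>T h\<close> and \<open>T w\<close>. Since \<open>w\<close> again has mean zero, the gain bounds both factors.\<close>
lemma autocorrelation_bound:
  assumes f: "f \<in> L2_space \<mu>" and h: "h \<in> mean_zero_ball"
  shows "(L2_norm \<mu> (conv (adj f) (conv f h)))\<^sup>2 \<le> (conv_gain f)\<^sup>2"
proof -
  let ?w = "conv (adj f) (conv f h)"
  have hL: "h \<in> L2_space \<mu>" "(\<integral>x. h x \<partial>\<mu>) = 0" using h by (auto simp: mean_zero_ball_def)
  note L = f hL(1) adj_L2[OF f] convolution_L2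
  have w: "?w \<in> L2_space \<mu>" by (intro L)
  have mean: "(\<integral>x. ?w x \<partial>\<mu>) = 0"
    using hL by (simp add: integral_convolution L)
  have "complex_of_real ((L2_norm \<mu> ?w)\<^sup>2) = L2_inner \<mu> (conv f h) (conv f ?w)"
    by (subst convolution_adjoint'[symmetric]) (simp_all add: L2_inner_self L w)
  then have "(L2_norm \<mu> ?w)\<^sup>2 \<le> L2_norm \<mu> (conv f h) * L2_norm \<mu> (conv f ?w)"
    using L2_inner_bound[of "conv f h" \<mu> "conv f ?w"]
    by (metis L(1,2) abs_of_nonneg convolution_L2 norm_of_real w zero_le_power2)
  then have "((L2_norm \<mu> ?w)\<^sup>2)\<^sup>2 \<le> (L2_norm \<mu> (conv f h) * L2_norm \<mu> (conv f ?w))\<^sup>2"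
    by (rule power_mono) simp
  also have "\<dots> = (L2_norm \<mu> (conv f h))\<^sup>2 * (L2_norm \<mu> (conv f ?w))\<^sup>2"
    by (rule power_mult_distrib)
  also have "\<dots> \<le> conv_gain f * (conv_gain f * (L2_norm \<mu> ?w)\<^sup>2)"
    using conv_gain_upper[OF f h] conv_gain_bound[OF f w mean]
    by (intro mult_mono) (auto intro: order.trans[OF zero_le_power2])
  finally have "(L2_norm \<mu> ?w)\<^sup>2 * (L2_norm \<mu> ?w)\<^sup>2 \<le> (conv_gain f)\<^sup>2 * (L2_norm \<mu> ?w)\<^sup>2"
    by (simp add: power2_eq_square mult_ac)
  then show ?thesis
    by (cases "L2_norm \<mu> ?w = 0") (simp_all only: mult_le_cancel_right, auto)
qed

text \<open>Write \<open>T\<close> for convolution by \<open>f\<close> and \<open>\<Lambda>\<close> for its gain. Along a maximizing sequence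
  \<open>g n\<close> the images \<open>T (g n)\<close> converge, after passing to a subsequence, to some \<open>v\<close>, pointwise
  and, being uniformly bounded, also in \<open>L\<^sup>2\<close>. Maximality forces \<open>\<Lambda> g n - T\<^sup>* T (g n)\<close> to tend to
  \<open>0\<close>, so \<open>\<Lambda> g n\<close> tends to \<open>u = T\<^sup>* v\<close>. As \<open>u\<close> is given by this formula at
  every point, the eigenvalue equation holds everywhere and not only almost everywhere.\<close>
theorem extremal_eigenfunction:
  assumes f: "f \<in> L2_space \<mu>" and pos: "0 < conv_gain f"
  obtains u where "u \<in> L2_space \<mu>" "(\<integral>x. u x \<partial>\<mu>) = 0" "L2_norm \<mu> u \<noteq> 0"
    "\<And>x. conv (adj f) (conv f u) x = of_real (conv_gain f) * u x"
proof -
  let ?\<Lambda> = "conv_gain f" and ?A = "\<lambda>h. conv (adj f) (conv f h)"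
  have "(\<lambda>_. 0) \<in> mean_zero_ball"
    by (simp add: mean_zero_ball_def L2_zero L2_norm_def)
  then have ne: "mean_zero_ball \<noteq> {}" by blast
  have "\<exists>h\<in>mean_zero_ball. ?\<Lambda> - 1 / real (Suc n) < (L2_norm \<mu> (conv f h))\<^sup>2" for n
    using less_cSUP_iff[of mean_zero_ball "\<lambda>h. (L2_norm \<mu> (conv f h))\<^sup>2" "?\<Lambda> - 1 / real (Suc n)",
        OF ne bdd_aboveI2[OF conv_gain_upper[OF f]]]
    unfolding conv_gain_def[symmetric] by simp
  then obtain h0 where h0: "\<And>n::nat. h0 n \<in> mean_zero_ball"
    "\<And>n. ?\<Lambda> - 1 / real (Suc n) < (L2_norm \<mu> (conv f (h0 n)))\<^sup>2"
    by metis
  have "h0 n \<in> L2_space \<mu>" "L2_norm \<mu> (h0 n) \<le> 1" for n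
    using h0(1) by (auto simp: mean_zero_ball_def)
  then obtain r :: "nat \<Rightarrow> nat" and v
    where r: "strict_mono r" and v: "\<And>x. (\<lambda>n. conv f (h0 (r n)) x) \<longlonglongrightarrow> v x"
    using convolution_compact[OF f] by metis
  define g where "g n = h0 (r n)" for n
  have gball: "g n \<in> mean_zero_ball" for n using h0(1) by (simp add: g_def)
  then have g: "g n \<in> L2_space \<mu>" "(\<integral>x. g n x \<partial>\<mu>) = 0" "L2_norm \<mu> (g n) \<le> 1" for n
    by (auto simp: mean_zero_ball_def)
  have Tg: "conv f (g n) \<in> L2_space \<mu>" and Ag: "?A (g n) \<in> L2_space \<mu>"
    and \<Lambda>g: "(\<lambda>x. of_real ?\<Lambda> * g n x) \<in> L2_space \<mu>" for n
    by (intro convolution_L2 adj_L2 L2_cmult f g)+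
  have gain: "(\<lambda>n. (L2_norm \<mu> (conv f (g n)))\<^sup>2) \<longlonglongrightarrow> ?\<Lambda>"
  proof (rule tendsto_sandwich[OF _ _ _ tendsto_const])
    have "(\<lambda>n. ?\<Lambda> - 1 / real (Suc n)) \<longlonglongrightarrow> ?\<Lambda> - 0"
      by (intro tendsto_diff tendsto_const LIMSEQ_Suc[OF lim_1_over_n])
    from LIMSEQ_subseq_LIMSEQ[OF this r]
    show "(\<lambda>n. ?\<Lambda> - 1 / real (Suc (r n))) \<longlonglongrightarrow> ?\<Lambda>" by (simp add: comp_def)
    show "\<forall>\<^sub>F n in sequentially. ?\<Lambda> - 1 / real (Suc (r n)) \<le> (L2_norm \<mu> (conv f (g n)))\<^sup>2"
      using h0(2) by (simp add: g_def less_imp_le)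
    show "\<forall>\<^sub>F n in sequentially. (L2_norm \<mu> (conv f (g n)))\<^sup>2 \<le> ?\<Lambda>"
      using conv_gain_upper[OF f gball] by simp
  qed
  have bound: "cmod (conv f (g n) x) \<le> L2_norm \<mu> f" for n x
    using convolution_bound[OF f g(1)[of n], of x] mult_left_mono[OF g(3)[of n], of "L2_norm \<mu> f"] by simp
  have v': "(\<lambda>n. conv f (g n) x) \<longlonglongrightarrow> v x" for x
    using v by (simp add: g_def)
  have vL: "v \<in> L2_space \<mu>"
  proof (rule L2_bounded)
    show "v \<in> borel_measurable \<mu>"
      by (rule borel_measurable_LIMSEQ_metric[OF L2_measurable[OF Tg] v'])
    show "cmod (v x) \<le> L2_norm \<mu> f" for x
      by (rule Lim_bounded[OF tendsto_norm[OF v'[of x]], of 0]) (use bound in auto)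
  qed
  have Tg_v: "(\<lambda>n. L2_norm \<mu> (\<lambda>x. conv f (g n) x - v x)) \<longlonglongrightarrow> 0"
    by (rule L2_norm_tendsto_bounded[OF L2_measurable[OF Tg] bound v'])
  define u where "u = conv (adj f) v"
  have uL: "u \<in> L2_space \<mu>" unfolding u_def by (intro convolution_L2 adj_L2 f vL)
  have Ag_u: "(\<lambda>n. L2_norm \<mu> (\<lambda>x. ?A (g n) x - u x)) \<longlonglongrightarrow> 0"
  proof (rule tendsto_sandwich[OF _ _ tendsto_const])
    show "(\<lambda>n. L2_norm \<mu> (adj f) * L2_norm \<mu> (\<lambda>x. conv f (g n) x - v x)) \<longlonglongrightarrow> 0"
      using tendsto_mult_left[OF Tg_v] by simp
    have "(\<lambda>x. ?A (g n) x - u x) = conv (adj f) (\<lambda>x. conv f (g n) x - v x)" for n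
      unfolding u_def by (intro ext convolution_diff[symmetric] adj_L2 f Tg vL)
    then show "\<forall>\<^sub>F n in sequentially. L2_norm \<mu> (\<lambda>x. ?A (g n) x - u x)
        \<le> L2_norm \<mu> (adj f) * L2_norm \<mu> (\<lambda>x. conv f (g n) x - v x)"
      using L2_norm_convolution_le[OF adj_L2[OF f] L2_diff[OF Tg vL]] by simp
  qed simp
  \<comment> \<open>Expand the square: the cross term is \<open>2 \<Lambda> \<parallel>T (g n)\<parallel>\<^sup>2\<close>, and the two squares are at
    most \<open>\<Lambda>\<^sup>2\<close> each.\<close>
  have eig: "(L2_norm \<mu> (\<lambda>x. of_real ?\<Lambda> * g n x - ?A (g n) x))\<^sup>2
      \<le> 2 * ?\<Lambda> * (?\<Lambda> - (L2_norm \<mu> (conv f (g n)))\<^sup>2)" for n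
  proof -
    have "L2_inner \<mu> (\<lambda>x. of_real ?\<Lambda> * g n x) (?A (g n))
        = of_real (?\<Lambda> * (L2_norm \<mu> (conv f (g n)))\<^sup>2)"
      unfolding L2_inner_cmult_left
      using convolution_adjoint[OF f g(1)[of n] Tg[of n]] by (simp add: L2_inner_self)
    then have "(L2_norm \<mu> (\<lambda>x. of_real ?\<Lambda> * g n x - ?A (g n) x))\<^sup>2
        = (L2_norm \<mu> (\<lambda>x. of_real ?\<Lambda> * g n x))\<^sup>2 - 2 * (?\<Lambda> * (L2_norm \<mu> (conv f (g n)))\<^sup>2)
          + (L2_norm \<mu> (?A (g n)))\<^sup>2"
      unfolding L2_norm_diff_square[OF \<Lambda>g Ag] by simp
    moreover have "(L2_norm \<mu> (\<lambda>x. of_real ?\<Lambda> * g n x))\<^sup>2 \<le> ?\<Lambda>\<^sup>2"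
      using pos g(3)[of n] unfolding L2_norm_cmult by (simp add: mult_left_le power_mono)
    moreover have "(L2_norm \<mu> (?A (g n)))\<^sup>2 \<le> ?\<Lambda>\<^sup>2"
      by (rule autocorrelation_bound[OF f gball])
    ultimately show ?thesis by (simp add: algebra_simps power2_eq_square)
  qed
  have g_u: "(\<lambda>n. L2_norm \<mu> (\<lambda>x. of_real ?\<Lambda> * g n x - u x)) \<longlonglongrightarrow> 0"
  proof -
    have "(\<lambda>n. (L2_norm \<mu> (\<lambda>x. of_real ?\<Lambda> * g n x - u x))\<^sup>2) \<longlonglongrightarrow> 0"
    proof (rule tendsto_sandwich[OF _ _ tendsto_const])
      have "(\<lambda>n. 2 * (2 * ?\<Lambda> * (?\<Lambda> - (L2_norm \<mu> (conv f (g n)))\<^sup>2))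
          + 2 * (L2_norm \<mu> (\<lambda>x. ?A (g n) x - u x))\<^sup>2) \<longlonglongrightarrow> 2 * (2 * ?\<Lambda> * (?\<Lambda> - ?\<Lambda>)) + 2 * 0\<^sup>2"
        by (intro tendsto_intros gain Ag_u)
      then show "(\<lambda>n. 2 * (2 * ?\<Lambda> * (?\<Lambda> - (L2_norm \<mu> (conv f (g n)))\<^sup>2))
          + 2 * (L2_norm \<mu> (\<lambda>x. ?A (g n) x - u x))\<^sup>2) \<longlonglongrightarrow> 0" by simp
      have "(L2_norm \<mu> (\<lambda>x. of_real ?\<Lambda> * g n x - u x))\<^sup>2
          \<le> 2 * (2 * ?\<Lambda> * (?\<Lambda> - (L2_norm \<mu> (conv f (g n)))\<^sup>2))
            + 2 * (L2_norm \<mu> (\<lambda>x. ?A (g n) x - u x))\<^sup>2" for n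
        using L2_norm_diff_square_le[OF \<Lambda>g[of n] Ag[of n] uL] eig[of n] by linarith
      then show "\<forall>\<^sub>F n in sequentially. (L2_norm \<mu> (\<lambda>x. of_real ?\<Lambda> * g n x - u x))\<^sup>2
          \<le> 2 * (2 * ?\<Lambda> * (?\<Lambda> - (L2_norm \<mu> (conv f (g n)))\<^sup>2))
            + 2 * (L2_norm \<mu> (\<lambda>x. ?A (g n) x - u x))\<^sup>2" by simp
    qed simp
    from tendsto_real_sqrt[OF this] show ?thesis by simp
  qed
  have Tu: "conv f u x = of_real ?\<Lambda> * v x" for x
  proof (rule LIMSEQ_unique)
    show "(\<lambda>n. of_real ?\<Lambda> * conv f (g n) x) \<longlonglongrightarrow> of_real ?\<Lambda> * v x"
      by (intro tendsto_intros v')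
    have "(\<lambda>n. of_real ?\<Lambda> * conv f (g n) x - conv f u x) \<longlonglongrightarrow> 0"
    proof (rule Lim_null_comparison)
      show "(\<lambda>n. L2_norm \<mu> f * L2_norm \<mu> (\<lambda>x. of_real ?\<Lambda> * g n x - u x)) \<longlonglongrightarrow> 0"
        using tendsto_mult_left[OF g_u] by simp
      show "\<forall>\<^sub>F n in sequentially. norm (of_real ?\<Lambda> * conv f (g n) x - conv f u x)
          \<le> L2_norm \<mu> f * L2_norm \<mu> (\<lambda>x. of_real ?\<Lambda> * g n x - u x)"
        using convolution_bound[OF f L2_diff[OF \<Lambda>g uL], of _ x]
        by (simp add: convolution_diff[OF f \<Lambda>g uL] convolution_cmult)
    qed
    from tendsto_add[OF this tendsto_const[of "conv f u x"]]
    show "(\<lambda>n. of_real ?\<Lambda> * conv f (g n) x) \<longlonglongrightarrow> conv f u x" by simp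
  qed
  show thesis
  proof (rule that[OF uL])
    have "(\<lambda>n. \<integral>x. of_real ?\<Lambda> * g n x - u x \<partial>\<mu>) \<longlonglongrightarrow> 0"
      by (rule Lim_null_comparison[OF _ g_u]) (simp add: L2_norm_integral_le L2_diff \<Lambda>g uL)
    moreover have "(\<integral>x. of_real ?\<Lambda> * g n x - u x \<partial>\<mu>) = - (\<integral>x. u x \<partial>\<mu>)" for n
      using L2_integrable[OF \<Lambda>g[of n]] L2_integrable[OF uL] g(2)[of n] by simp
    ultimately show "(\<integral>x. u x \<partial>\<mu>) = 0"
      by (simp add: LIMSEQ_const_iff)
    show "L2_norm \<mu> u \<noteq> 0"
    proof
      \<comment> \<open>Otherwise \<open>T (g n)\<close> would tend to \<open>0\<close>, whereas its squared norm tends to \<open>\<Lambda> > 0\<close>.\<close>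
      assume 0: "L2_norm \<mu> u = 0"
      have "v x = 0" for x
        using convolution_bound[OF f uL, of x] Tu[of x] pos 0 by simp
      then have "(\<lambda>n. (L2_norm \<mu> (conv f (g n)))\<^sup>2) \<longlonglongrightarrow> 0\<^sup>2"
        using Tg_v by (intro tendsto_power) simp
      from LIMSEQ_unique[OF this gain] pos show False by simp
    qed
    have "conv f u = (\<lambda>x. of_real ?\<Lambda> * v x)" by (rule ext) (rule Tu)
    then show "conv (adj f) (conv f u) x = of_real ?\<Lambda> * u x" for x
      by (simp add: convolution_cmult u_def)
  qed
qed

section \<open>The representation on an eigenspace\<close>

text \<open>The matrix of the right translation \<open>u \<mapsto> (\<lambda>x. u (x + g))\<close> in the system \<open>e\<close>. Right
  translations compose in the order of the group law, so no inverse occurs.\<close>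
definition translation_matrix :: "nat \<Rightarrow> (nat \<Rightarrow> 'a \<Rightarrow> complex) \<Rightarrow> 'a \<Rightarrow> complex mat" where
  "translation_matrix d e g = mat d d (\<lambda>(i, j). L2_inner \<mu> (\<lambda>x. e j (x + g)) (e i))"

text \<open>The completeness assumption says that the span of \<open>e\<close> is invariant under translations, up to
  functions of norm zero. Those are orthogonal to everything, so they do not disturb the
  multiplication law.\<close>
lemma translation_matrix_representation:
  assumes e: "orthonormal_system \<mu> d e"
    and complete: "\<And>j g. j < d \<Longrightarrow> L2_norm \<mu> (\<lambda>x. e j (x + g)
        - (\<Sum>k<d. L2_inner \<mu> (\<lambda>x. e j (x + g)) (e k) * e k x)) = 0"
  shows "continuous_representation d (translation_matrix d e)"
  unfolding continuous_representation_def
proof (intro conjI allI impI)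
  have eL: "e i \<in> L2_space \<mu>" if "i < d" for i
    using e that by (auto simp: orthonormal_system_def)
  note transL = L2_preserved[OF preserves_translation(2)]
  show "translation_matrix d e x \<in> carrier_mat d d" for x
    by (simp add: translation_matrix_def)
  show "translation_matrix d e 0 = 1\<^sub>m d"
    using e by (intro eq_matI) (auto simp: translation_matrix_def orthonormal_system_def)
  show "translation_matrix d e (g + h) = translation_matrix d e g * translation_matrix d e h" for g h
  proof (rule eq_matI)
    fix i j assume "i < dim_row (translation_matrix d e g * translation_matrix d e h)"
      "j < dim_col (translation_matrix d e g * translation_matrix d e h)"
    then have ij: "i < d" "j < d" by (simp_all add: translation_matrix_def)
    let ?c = "\<lambda>k. L2_inner \<mu> (\<lambda>x. e j (x + h)) (e k)"
    let ?p = "\<lambda>x. \<Sum>k<d. ?c k * e k x"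
    let ?w = "\<lambda>x. e j (x + h) - ?p x"
    have p: "?p \<in> L2_space \<mu>" by (intro L2_sum L2_cmult eL) auto
    have w: "?w \<in> L2_space \<mu>" by (intro L2_diff p transL eL ij)
    have "L2_norm \<mu> (\<lambda>x. ?w (x + g)) = 0"
      using L2_norm_preserved[OF preserves_translation(2) w] complete[OF ij(2)] by simp
    then have "0 = L2_inner \<mu> (\<lambda>x. ?w (x + g)) (e i)"
      using L2_inner_null[OF transL[OF w] eL[OF ij(1)]] by simp
    also have "\<dots> = L2_inner \<mu> (\<lambda>x. e j (x + g + h)) (e i) - L2_inner \<mu> (\<lambda>x. ?p (x + g)) (e i)"
      by (intro L2_inner_diff_left transL[OF p] eL ij transL[OF transL[OF eL[OF ij(2)]]])
    also have "L2_inner \<mu> (\<lambda>x. ?p (x + g)) (e i)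
        = (\<Sum>k<d. ?c k * L2_inner \<mu> (\<lambda>x. e k (x + g)) (e i))"
      using ij by (subst L2_inner_sum_left)
        (auto simp: L2_inner_cmult_left intro!: L2_cmult transL eL)
    finally show "translation_matrix d e (g + h) $$ (i, j)
        = (translation_matrix d e g * translation_matrix d e h) $$ (i, j)"
      using ij by (simp add: translation_matrix_def scalar_prod_def add.assoc lessThan_atLeast0 mult.commute)
  qed (simp_all add: translation_matrix_def)
  show "continuous_on UNIV (\<lambda>x. translation_matrix d e x $$ (i, j))" if ij: "i < d" "j < d" for i j
    unfolding continuous_on_def tendsto_at_iff_sequentially comp_def
  proof (intro ballI allI impI)
    fix g X assume X: "X \<longlonglongrightarrow> (g::'a)"
    let ?q = "\<lambda>n. L2_norm \<mu> (\<lambda>x. e j (x + X n) - e j (x + g))"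
    have "(\<lambda>n. L2_inner \<mu> (\<lambda>x. e j (x + X n)) (e i) - L2_inner \<mu> (\<lambda>x. e j (x + g)) (e i)) \<longlonglongrightarrow> 0"
    proof (rule Lim_null_comparison)
      show "(\<lambda>n. ?q n * L2_norm \<mu> (e i)) \<longlonglongrightarrow> 0"
        using tendsto_mult_right[OF right_translation_L2_continuous[OF eL[OF ij(2)] X]] by simp
      show "\<forall>\<^sub>F n in sequentially. norm (L2_inner \<mu> (\<lambda>x. e j (x + X n)) (e i)
          - L2_inner \<mu> (\<lambda>x. e j (x + g)) (e i)) \<le> ?q n * L2_norm \<mu> (e i)"
        using L2_inner_bound[OF L2_diff[OF transL transL] eL]
        by (simp add: L2_inner_diff_left[symmetric] transL eL ij)
    qed
    from tendsto_add[OF this tendsto_const[of "L2_inner \<mu> (\<lambda>x. e j (x + g)) (e i)"]]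
    show "(\<lambda>n. translation_matrix d e (X n) $$ (i, j)) \<longlonglongrightarrow> translation_matrix d e g $$ (i, j)"
      using ij by (simp add: translation_matrix_def)
  qed
qed

text \<open>The first diagonal coefficient is a convolution of \<open>adj (e 0)\<close> with \<open>e 0\<close>, up to inversion and
  conjugation. Its mean is a multiple of the mean of \<open>e 0\<close>, hence \<open>0\<close>; for the trivial
  representation it would be constantly \<open>1\<close>.\<close>
lemma translation_matrix_nontrivial:
  assumes e: "orthonormal_system \<mu> d e" and "0 < d" and mean: "(\<integral>x. e 0 x \<partial>\<mu>) = 0"
  shows "nontrivial_representation d (translation_matrix d e)"
  unfolding nontrivial_representation_def
proof (rule ccontr)
  assume "\<nexists>x. translation_matrix d e x \<noteq> 1\<^sub>m d"
  then have "translation_matrix d e g $$ (0, 0) = 1" for g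
    using \<open>0 < d\<close> by simp
  then have one: "L2_inner \<mu> (\<lambda>x. e 0 (x + g)) (e 0) = 1" for g
    using \<open>0 < d\<close> by (simp add: translation_matrix_def)
  have e0: "e 0 \<in> L2_space \<mu>" using e \<open>0 < d\<close> by (auto simp: orthonormal_system_def)
  have "conv (adj (e 0)) (e 0) g = cnj (L2_inner \<mu> (\<lambda>x. e 0 (x + - g)) (e 0))" for g
    unfolding L2_inner_def convolution_def adj_def
    by (simp add: mult.commute flip: Bochner_Integration.integral_cnj)
  then have "conv (adj (e 0)) (e 0) g = 1" for g
    using one[of "- g"] by simp
  then have "(\<integral>x. conv (adj (e 0)) (e 0) x \<partial>\<mu>) = 1" by simp
  then show False
    using integral_convolution[OF adj_L2[OF e0] e0] mean by simp
qed

text \<open>Both estimates of the dimension \<open>d\<close> of the eigenspace \<open>E\<close> of the gain: it is at least \<open>m\<close>,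
  being the dimension of a nontrivial representation, and at most \<open>\<parallel>f\<parallel>\<^sup>2\<close> divided by the gain,
  because orthonormal eigenvectors have images of squared norm equal to the gain.\<close>
theorem conv_gain_le:
  fixes m :: nat
  assumes f: "f \<in> L2_space \<mu>"
    and m: "\<And>n (\<pi> :: 'a \<Rightarrow> complex mat).
      continuous_representation n \<pi> \<Longrightarrow> nontrivial_representation n \<pi> \<Longrightarrow> m \<le> n"
  shows "real m * conv_gain f \<le> (L2_norm \<mu> f)\<^sup>2"
proof (cases "0 < conv_gain f")
  case False
  then have "real m * conv_gain f \<le> 0" by (simp add: mult_nonneg_nonpos)
  then show ?thesis using zero_le_power2[of "L2_norm \<mu> f"] by linarith
next
  case pos: True
  let ?\<Lambda> = "conv_gain f"
  define E where "E = {u \<in> L2_space \<mu>. (\<integral>x. u x \<partial>\<mu>) = 0 \<and>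
    (\<forall>x. conv (adj f) (conv f u) x = of_real ?\<Lambda> * u x)}"
  have EL: "u \<in> L2_space \<mu>" if "u \<in> E" for u using that by (simp add: E_def)
  have E_mean: "(\<integral>x. u x \<partial>\<mu>) = 0" if "u \<in> E" for u using that by (simp add: E_def)
  have size: "real k * ?\<Lambda> \<le> (L2_norm \<mu> f)\<^sup>2"
    if e: "orthonormal_system \<mu> k e" "\<And>i. i < k \<Longrightarrow> e i \<in> E" for k e
  proof -
    have "(L2_norm \<mu> (conv f (e i)))\<^sup>2 = ?\<Lambda>" if "i < k" for i
    proof -
      have "e i \<in> E" by (rule e(2)[OF that])
      then have ei: "e i \<in> L2_space \<mu>" "conv (adj f) (conv f (e i)) = (\<lambda>x. of_real ?\<Lambda> * e i x)"
        by (auto simp: E_def)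
      have "complex_of_real ((L2_norm \<mu> (conv f (e i)))\<^sup>2) = L2_inner \<mu> (e i) (\<lambda>x. of_real ?\<Lambda> * e i x)"
        using convolution_adjoint[OF f ei(1) convolution_L2[OF f ei(1)]]
        by (simp add: L2_inner_self ei(2))
      also have "\<dots> = of_real ?\<Lambda>"
        using e(1) that by (simp add: L2_inner_cmult_right orthonormal_system_def)
      finally show ?thesis by (simp only: of_real_eq_iff)
    qed
    then show ?thesis using Hilbert_Schmidt_bound[OF f e(1)] by simp
  qed
  have E_translate: "(\<lambda>x. u (x + g)) \<in> E" if u: "u \<in> E" for u g
  proof -
    have "conv f (\<lambda>x. u (x + g)) = (\<lambda>x. conv f u (x + g))"
      by (rule ext) (rule convolution_translate[OF f EL[OF u]])
    then have "conv (adj f) (conv f (\<lambda>x. u (x + g))) x = conv (adj f) (conv f u) (x + g)" for x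
      using convolution_translate[OF adj_L2[OF f] convolution_L2[OF f EL[OF u]]] by simp
    moreover have "(\<integral>x. u (x + g) \<partial>\<mu>) = (\<integral>x. u x \<partial>\<mu>)"
      by (rule integral_preserved[OF preserves_translation(2) L2_measurable[OF EL[OF u]]])
    ultimately show ?thesis
      using u L2_preserved[OF preserves_translation(2) EL[OF u]] by (simp add: E_def)
  qed
  have E_cmult: "(\<lambda>x. c * u x) \<in> E" if u: "u \<in> E" for c u
  proof -
    have "conv f (\<lambda>x. c * u x) = (\<lambda>x. c * conv f u x)"
      by (rule ext) (rule convolution_cmult)
    then have "conv (adj f) (conv f (\<lambda>x. c * u x)) x = c * conv (adj f) (conv f u) x" for x
      using convolution_cmult[of "adj f" c "conv f u" x] by (simp only:)
    then show ?thesis using u by (simp add: E_def L2_cmult)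
  qed
  have E_diff: "(\<lambda>x. u x - w x) \<in> E" if u: "u \<in> E" and w: "w \<in> E" for u w
  proof -
    have "conv f (\<lambda>x. u x - w x) = (\<lambda>x. conv f u x - conv f w x)"
      by (rule ext) (rule convolution_diff[OF f EL[OF u] EL[OF w]])
    then show ?thesis
      using u w by (simp add: E_def L2_diff convolution_diff adj_L2 f convolution_L2 L2_integrable
          right_diff_distrib)
  qed
  have sub: "E \<subseteq> L2_space \<mu>" using EL by blast
  have bounded: "k \<le> nat \<lfloor>(L2_norm \<mu> f)\<^sup>2 / ?\<Lambda>\<rfloor>"
    if "orthonormal_system \<mu> k e" "\<And>i. i < k \<Longrightarrow> e i \<in> E" for k e
    using size[OF that] pos by (simp add: le_nat_floor pos_le_divide_eq)
  obtain d e where e: "orthonormal_system \<mu> d e" "\<And>i. i < d \<Longrightarrow> e i \<in> E"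
    and complete: "\<And>u. u \<in> E \<Longrightarrow> L2_norm \<mu> (\<lambda>x. u x - (\<Sum>i<d. L2_inner \<mu> u (e i) * e i x)) = 0"
    by (rule exists_complete_orthonormal_system[OF sub E_cmult E_diff bounded]) blast+
  have "0 < d"
  proof (rule ccontr)
    assume "\<not> 0 < d"
    obtain u where "u \<in> E" "L2_norm \<mu> u \<noteq> 0"
      using extremal_eigenfunction[OF f pos] unfolding E_def by blast
    with complete[of u] \<open>\<not> 0 < d\<close> show False by simp
  qed
  have "m \<le> d"
  proof (rule m)
    show "continuous_representation d (translation_matrix d e)"
      using complete E_translate e by (intro translation_matrix_representation) auto
    show "nontrivial_representation d (translation_matrix d e)"
      using e \<open>0 < d\<close> E_mean by (intro translation_matrix_nontrivial) auto
  qed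
  then have "real m * ?\<Lambda> \<le> real d * ?\<Lambda>" using pos by simp
  also have "\<dots> \<le> (L2_norm \<mu> f)\<^sup>2" by (rule size[OF e])
  finally show ?thesis .
qed

lemma convolution_mean_zero_right:
  fixes m :: nat
  assumes f: "f \<in> L2_space \<mu>" and h: "h \<in> L2_space \<mu>" "(\<integral>x. h x \<partial>\<mu>) = 0" and "0 < m"
    and m: "\<And>n (\<pi> :: 'a \<Rightarrow> complex mat).
      continuous_representation n \<pi> \<Longrightarrow> nontrivial_representation n \<pi> \<Longrightarrow> m \<le> n"
  shows "L2_norm \<mu> (conv f h) \<le> sqrt (1 / real m) * L2_norm \<mu> f * L2_norm \<mu> h"
proof (rule power2_le_imp_le)
  have "conv_gain f \<le> 1 / real m * (L2_norm \<mu> f)\<^sup>2"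
    using conv_gain_le[OF f m] \<open>0 < m\<close> by (simp add: field_simps)
  from mult_right_mono[OF this, of "(L2_norm \<mu> h)\<^sup>2"]
  show "(L2_norm \<mu> (conv f h))\<^sup>2 \<le> (sqrt (1 / real m) * L2_norm \<mu> f * L2_norm \<mu> h)\<^sup>2"
    using conv_gain_bound[OF f h] by (simp add: power_mult_distrib)
qed simp

text \<open>Subtracting the mean is the orthogonal projection along the constants, so it does not increase
  the norm.\<close>
lemma centred:
  assumes h: "h \<in> L2_space \<mu>" and c: "c = (\<integral>x. h x \<partial>\<mu>)"
  shows "(\<lambda>x. h x - c) \<in> L2_space \<mu>" "(\<integral>x. h x - c \<partial>\<mu>) = 0"
    "L2_norm \<mu> (\<lambda>x. h x - c) \<le> L2_norm \<mu> h"
proof -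
  have const: "(\<lambda>_. c) \<in> L2_space \<mu>" by (simp add: L2_space_def)
  show "(\<lambda>x. h x - c) \<in> L2_space \<mu>" by (rule L2_diff[OF h const])
  show "(\<integral>x. h x - c \<partial>\<mu>) = 0" using L2_integrable[OF h] by (simp add: c)
  have "(L2_norm \<mu> (\<lambda>x. h x - c))\<^sup>2 = (L2_norm \<mu> h)\<^sup>2 - (cmod c)\<^sup>2"
    unfolding L2_norm_diff_square[OF h const]
    by (simp add: L2_inner_def c[symmetric] L2_norm_square complex_mult_cnj cmod_power2)
  then show "L2_norm \<mu> (\<lambda>x. h x - c) \<le> L2_norm \<mu> h"
    by (intro power2_le_imp_le[of "L2_norm \<mu> (\<lambda>x. h x - c)"]) simp_all
qed

end

theorem theorem3:
  fixes \<mu> :: "'a::{topological_group_add, t2_space, second_countable_topology} measure"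
    and m :: nat
    and f\<^sub>1 f\<^sub>2 :: "'a \<Rightarrow> complex"
  assumes "compact (UNIV :: 'a set)"
    and "normalized_haar_measure \<mu>"
    and "m > 0"
    and "\<And>n (\<pi> :: 'a \<Rightarrow> complex mat).
           continuous_representation n \<pi> \<Longrightarrow> nontrivial_representation n \<pi> \<Longrightarrow> m \<le> n"
    and "f\<^sub>1 \<in> L2_space \<mu>"
    and "f\<^sub>2 \<in> L2_space \<mu>"
    and "(\<integral>x. f\<^sub>1 x \<partial>\<mu>) = 0 \<or> (\<integral>x. f\<^sub>2 x \<partial>\<mu>) = 0"
  shows "convolution \<mu> f\<^sub>1 f\<^sub>2 \<in> L2_space \<mu> \<and>
         L2_norm \<mu> (convolution \<mu> f\<^sub>1 f\<^sub>2) \<le> sqrt (1 / real m) * L2_norm \<mu> f\<^sub>1 * L2_norm \<mu> f\<^sub>2"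
proof -
  interpret haar_probability \<mu> by standard (rule assms(2))
  note f = assms(5,6)
  have "L2_norm \<mu> (conv f\<^sub>1 f\<^sub>2) \<le> sqrt (1 / real m) * L2_norm \<mu> f\<^sub>1 * L2_norm \<mu> f\<^sub>2"
    using assms(7)
  proof
    assume "(\<integral>x. f\<^sub>2 x \<partial>\<mu>) = 0"
    then show ?thesis by (rule convolution_mean_zero_right[OF f _ assms(3,4)])
  next
    assume mean: "(\<integral>x. f\<^sub>1 x \<partial>\<mu>) = 0"
    define c where "c = (\<integral>x. f\<^sub>2 x \<partial>\<mu>)"
    note centred = centred[OF f(2) c_def]
    have const: "(\<lambda>_. c) \<in> L2_space \<mu>" by (simp add: L2_space_def)
    have "conv f\<^sub>1 (\<lambda>_. c) x = 0" for x
      using integral_preserved[OF preserves_reflection L2_measurable[OF f(1)]] mean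
      by (simp add: convolution_def)
    then have "conv f\<^sub>1 f\<^sub>2 = conv f\<^sub>1 (\<lambda>x. f\<^sub>2 x - c)"
      by (intro ext) (simp add: convolution_diff[OF f const])
    then have "L2_norm \<mu> (conv f\<^sub>1 f\<^sub>2) = L2_norm \<mu> (conv f\<^sub>1 (\<lambda>x. f\<^sub>2 x - c))"
      by (rule arg_cong)
    also have "\<dots> \<le> sqrt (1 / real m) * L2_norm \<mu> f\<^sub>1 * L2_norm \<mu> (\<lambda>x. f\<^sub>2 x - c)"
      by (rule convolution_mean_zero_right[OF f(1) centred(1,2) assms(3,4)])
    also have "\<dots> \<le> sqrt (1 / real m) * L2_norm \<mu> f\<^sub>1 * L2_norm \<mu> f\<^sub>2"
      by (intro mult_left_mono centred(3)) simp
    finally show ?thesis .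
  qed
  then show ?thesis using convolution_L2[OF f] by blast
qed

end
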